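(* Let $E$ be a Hermitian space of dimension $n$, let $h:E\to\mathbb{R}$ be a function of class $\mathscr{C}^1$, and assume that for some $\beta>0$, $z_\beta:=\int_Ee^{-\beta h(u)}\,dL<+\infty$, where $dL$ is the Lebesgue measure on $E$. Then a Borel probability measure $\mu$ on $E$ satisfies the KMS condition $$\int_E\{F,G\}(u)\,d\mu=\beta\int_E\{F,h\}(u)\,G(u)\,d\mu\qquad\text{for all }F,G\in\mathscr{C}_c^\infty(E)$$ (real-valued, compactly supported smooth functions) if and only if $\mu$ is the Gibbs measure $\mu_\beta=\frac1{z_\beta}e^{-\beta h(\cdot)}\,dL$.
   Context: $E$ is a finite-dimensional complex inner product space with complex dimension $n$ and orthonormal basis $\{e_1,\dots,e_n\}$; set $f_j=ie_j$, so that $\{e_1,\dots,e_n,f_1,\dots,f_n\}$ is an orthonormal basis of $E$ regarded as a real Euclidean space with $\mathrm{Re}\langle\cdot,\cdot\rangle$. $\frac{\partial F}{\partial e_j}$, $\frac{\partial F}{\partial f_j}$ are the directional derivatives along $e_j$, $f_j$ (real directions). The Poisson bracket of differentiable functions is $$\{F,G\}(u)=\sum_{j=1}^n\frac{\partial F}{\partial e_j}(u)\frac{\partial G}{\partial f_j}(u)-\frac{\partial G}{\partial e_j}(u)\frac{\partial F}{\partial f_j}(u).$$ *)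

theory Defs
  imports "HOL-Probability.Probability"
begin

text \<open>
  A finite-dimensional complex inner product space. The underlying real Euclidean structure
  is the one given by the real part of the Hermitian product, so \<^const>\<open>lborel\<close> is
  Lebesgue measure normalised by the real orthonormal bases of this structure. The axiom
  \<open>inner_eq_Re_cinner\<close> also yields positive definiteness. The product is linear in its first
  argument.
\<close>

class hermitian_space = euclidean_space +
  fixes scaleC :: "complex \<Rightarrow> 'a \<Rightarrow> 'a"  (infixr "*\<^sub>C" 75)
    and cinner :: "'a \<Rightarrow> 'a \<Rightarrow> complex"
  assumes scaleC_add_right: "a *\<^sub>C (x + y) = a *\<^sub>C x + a *\<^sub>C y"
    and scaleC_add_left: "(a + b) *\<^sub>C x = a *\<^sub>C x + b *\<^sub>C x"
    and scaleC_scaleC: "a *\<^sub>C b *\<^sub>C x = (a * b) *\<^sub>C x"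
    and scaleC_of_real: "complex_of_real r *\<^sub>C x = scaleR r x"
    and cinner_commute: "cinner x y = cnj (cinner y x)"
    and cinner_add_left: "cinner (x + y) z = cinner x z + cinner y z"
    and cinner_scaleC_left: "cinner (a *\<^sub>C x) y = a * cinner x y"
    and inner_eq_Re_cinner: "inner x y = Re (cinner x y)"

instantiation complex :: hermitian_space
begin

definition scaleC_complex :: "complex \<Rightarrow> complex \<Rightarrow> complex"
  where "scaleC_complex a x = a * x"

definition cinner_complex :: "complex \<Rightarrow> complex \<Rightarrow> complex"
  where "cinner_complex x y = x * cnj y"

instance
  by standard
    (auto simp: scaleC_complex_def cinner_complex_def algebra_simps inner_complex_def
      scaleR_conv_of_real)

end

instantiation vec :: (hermitian_space, finite) hermitian_space
begin

definition scaleC_vec :: "complex \<Rightarrow> 'a ^ 'b \<Rightarrow> 'a ^ 'b"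
  where "scaleC_vec a x = (\<chi> i. a *\<^sub>C (x $ i))"

definition cinner_vec :: "'a ^ 'b \<Rightarrow> 'a ^ 'b \<Rightarrow> complex"
  where "cinner_vec x y = (\<Sum>i\<in>UNIV. cinner (x $ i) (y $ i))"

instance
proof
  fix x y :: "'a ^ 'b"
  show "cinner x y = cnj (cinner y x)"
    unfolding cinner_vec_def cnj_sum by (intro sum.cong refl cinner_commute)
qed (auto simp: scaleC_vec_def cinner_vec_def vec_eq_iff scaleC_add_right scaleC_add_left
      scaleC_scaleC scaleC_of_real cinner_add_left cinner_scaleC_left inner_vec_def
      inner_eq_Re_cinner sum.distrib sum_distrib_left)

end

definition unitary_basis :: "nat \<Rightarrow> (nat \<Rightarrow> 'a::hermitian_space) \<Rightarrow> bool"
  where "unitary_basis n e \<longleftrightarrow>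
    (\<forall>j\<in>{1..n}. \<forall>k\<in>{1..n}. cinner (e j) (e k) = (if j = k then 1 else 0)) \<and>
    (\<forall>x. \<exists>c. x = (\<Sum>j=1..n. c j *\<^sub>C e j))"

definition dir_deriv :: "('a::real_normed_vector \<Rightarrow> real) \<Rightarrow> 'a \<Rightarrow> 'a \<Rightarrow> real"
  where "dir_deriv F v u = deriv (\<lambda>t::real. F (u + t *\<^sub>R v)) 0"

text \<open>
  Functions of class \<open>C\<^sup>k\<close> on the whole space. As the space is finite-dimensional, continuity of
  the total derivative is the same as continuity of all the directional derivatives.
\<close>

primrec class_C :: "nat \<Rightarrow> ('a::euclidean_space \<Rightarrow> real) \<Rightarrow> bool"
  where
    "class_C 0 F \<longleftrightarrow> continuous_on UNIV F"
  | "class_C (Suc k) F \<longleftrightarrow> (\<forall>u. F differentiable (at u)) \<and> (\<forall>v. class_C k (dir_deriv F v))"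

definition test_function :: "('a::euclidean_space \<Rightarrow> real) \<Rightarrow> bool"
  where "test_function F \<longleftrightarrow> (\<forall>k. class_C k F) \<and> compact (closure {u. F u \<noteq> 0})"

definition poisson_bracket ::
    "nat \<Rightarrow> (nat \<Rightarrow> 'a::hermitian_space) \<Rightarrow> ('a \<Rightarrow> real) \<Rightarrow> ('a \<Rightarrow> real) \<Rightarrow> 'a \<Rightarrow> real"
  where "poisson_bracket n e F G u =
    (\<Sum>j=1..n. dir_deriv F (e j) u * dir_deriv G (\<i> *\<^sub>C e j) u
             - dir_deriv G (e j) u * dir_deriv F (\<i> *\<^sub>C e j) u)"

text \<open>
  Both integrands below are continuous with compact support when \<open>h\<close> is of class \<open>C\<^sup>1\<close>, so the
  Bochner integrals are genuine.
\<close>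

definition KMS_condition ::
    "nat \<Rightarrow> (nat \<Rightarrow> 'a::hermitian_space) \<Rightarrow> real \<Rightarrow> ('a \<Rightarrow> real) \<Rightarrow> 'a measure \<Rightarrow> bool"
  where "KMS_condition n e \<beta> h \<mu> \<longleftrightarrow>
    (\<forall>F G. test_function F \<longrightarrow> test_function G \<longrightarrow>
      (\<integral>u. poisson_bracket n e F G u \<partial>\<mu>) = \<beta> * (\<integral>u. poisson_bracket n e F h u * G u \<partial>\<mu>))"

definition partition_function :: "real \<Rightarrow> ('a::euclidean_space \<Rightarrow> real) \<Rightarrow> ennreal"
  where "partition_function \<beta> h = (\<integral>\<^sup>+u. ennreal (exp (- \<beta> * h u)) \<partial>lborel)"

definition gibbs_measure :: "real \<Rightarrow> ('a::euclidean_space \<Rightarrow> real) \<Rightarrow> 'a measure"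
  where "gibbs_measure \<beta> h =
    density lborel (\<lambda>u. ennreal (exp (- \<beta> * h u)) / partition_function \<beta> h)"

end

theory Submission
  imports Defs
begin

text \<open>
  If \<open>w\<close> denotes \<open>exp (- \<beta> h)\<close>, the Leibniz rule gives \<open>{F, G w} = w {F, G} - \<beta> w {F, h} G\<close>,
  and the Lebesgue integral of a Poisson bracket of compactly supported functions vanishes; hence the
  Gibbs measure satisfies the KMS condition. Conversely, functions \<open>F\<close> that are linear on the support of
  \<open>G\<close> reduce the KMS condition to \<open>\<integral> \<partial>\<^sub>v G d\<mu> = \<beta> \<integral> (\<partial>\<^sub>v h) G d\<mu>\<close> for all directions \<open>v\<close>. As \<open>h\<close> is only
  \<open>C\<^sup>1\<close>, mollification is needed to extend this to \<open>C\<^sup>1\<close> functions \<open>G\<close> with compact support; then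
  \<open>G = exp (\<beta> h) \<phi>\<close> is admissible and shows that \<open>exp (\<beta> h) \<mu>\<close> is translation invariant, thus a
  multiple of Lebesgue measure by Fubini's theorem.
\<close>

section \<open>Functions of class \<open>C\<^sup>k\<close>\<close>

text \<open>All the analysis rests on one family of integrals,
  \<open>\<integral>y. g y * K (u + s *\<^sub>R y) \<partial>M\<close> with \<open>s\<close> equal
  to 1 or -1, seen as functions of \<open>u\<close>. Derivatives fall on \<open>K\<close> alone, so
  \<open>g\<close> may be merely continuous and \<open>M\<close> merely finite on balls. With
  Lebesgue measure this gives the smoothness of mollifications and the vanishing of integrals of
  derivatives; with \<open>\<mu>\<close> and the weight \<open>exp (\<beta> * h y)\<close> it gives
  translation invariance. The low regularity of \<open>h\<close> is felt in both directions: the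
  product of \<open>G\<close> with the Gibbs weight is only C^1 as well, so the integral of a
  bracket has to vanish without second derivatives being formed. Nor is the growth of
  \<open>h\<close> at infinity controlled, so the measure with density
  \<open>exp (\<beta> * h y)\<close> with respect to \<open>\<mu>\<close> is never constructed: only
  its values on functions of bounded support enter. Finiteness of the partition function finally
  brings the question back to a comparison of two finite measures.\<close>

lemma dir_deriv_eq:
  assumes "(F has_derivative D) (at u)"
  shows "dir_deriv F v u = D v"
proof -
  interpret D: bounded_linear D
    using assms by (rule has_derivative_bounded_linear)
  have "((\<lambda>t::real. u + t *\<^sub>R v) has_derivative (\<lambda>t. t *\<^sub>R v)) (at 0)"
    by (auto intro!: derivative_eq_intros)
  then have "((\<lambda>t::real. F (u + t *\<^sub>R v)) has_derivative (\<lambda>t. D (t *\<^sub>R v))) (at 0)"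
    by (rule has_derivative_compose) (use assms in simp)
  then have "((\<lambda>t::real. F (u + t *\<^sub>R v)) has_real_derivative D v) (at 0)"
    by (simp add: has_field_derivative_def D.scaleR mult_commute_abs)
  then show ?thesis
    unfolding dir_deriv_def by (rule DERIV_imp_deriv)
qed

lemma has_derivative_dir_deriv:
  assumes "F differentiable (at u)"
  shows "(F has_derivative (\<lambda>v. dir_deriv F v u)) (at u)"
proof -
  obtain D where D: "(F has_derivative D) (at u)"
    using assms by (auto simp: differentiable_def)
  then have "(\<lambda>v. dir_deriv F v u) = D"
    by (auto simp: dir_deriv_eq)
  with D show ?thesis by simp
qed

lemma dir_deriv_const [simp]: "dir_deriv (\<lambda>u. c) v = (\<lambda>u. 0)"
  by (auto simp: dir_deriv_eq[OF has_derivative_const])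

lemma dir_deriv_inner [simp]: "dir_deriv (\<lambda>u. u \<bullet> a) v = (\<lambda>u. v \<bullet> a)"
proof
  fix u
  have "((\<lambda>u. u \<bullet> a) has_derivative (\<lambda>v. v \<bullet> a)) (at u)"
    by (auto intro!: derivative_eq_intros)
  then show "dir_deriv (\<lambda>u. u \<bullet> a) v u = v \<bullet> a"
    by (rule dir_deriv_eq)
qed

lemma dir_deriv_add:
  assumes "F differentiable (at u)" "G differentiable (at u)"
  shows "dir_deriv (\<lambda>u. F u + G u) v u = dir_deriv F v u + dir_deriv G v u"
  by (intro dir_deriv_eq has_derivative_add has_derivative_dir_deriv assms)

lemma dir_deriv_mult:
  assumes "F differentiable (at u)" "G differentiable (at u)"
  shows "dir_deriv (\<lambda>u. F u * G u) v u = F u * dir_deriv G v u + dir_deriv F v u * G u"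
  by (intro dir_deriv_eq has_derivative_mult has_derivative_dir_deriv assms)

lemma dir_deriv_compose:
  assumes "(f has_real_derivative f') (at (F u))" "F differentiable (at u)"
  shows "dir_deriv (\<lambda>u. f (F u)) v u = f' * dir_deriv F v u"
  using has_derivative_compose[OF has_derivative_dir_deriv[OF assms(2)]
      assms(1)[unfolded has_field_derivative_def]]
  by (rule dir_deriv_eq)

lemma dir_deriv_translate: "dir_deriv (\<lambda>u. F (u + a)) v u = dir_deriv F v (u + a)"
  by (simp add: dir_deriv_def algebra_simps)

lemma linear_dir_deriv:
  assumes "F differentiable (at u)"
  shows "linear (\<lambda>v. dir_deriv F v u)"
  using has_derivative_linear[OF has_derivative_dir_deriv[OF assms]] .

section \<open>Closure properties of the classes C^k\<close>

lemma class_C_SucD: "class_C (Suc k) F \<Longrightarrow> class_C k F"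
proof (induction k arbitrary: F)
  case 0
  then show ?case
    by (auto intro!: continuous_at_imp_continuous_on differentiable_imp_continuous_within)
qed auto

lemma class_C_mono:
  assumes "class_C m F" "k \<le> m"
  shows "class_C k F"
  using assms(2,1) by (induction rule: dec_induct) (auto dest!: class_C_SucD simp del: class_C.simps)

lemma class_C_continuous: "class_C k F \<Longrightarrow> continuous_on UNIV F"
  using class_C_mono[of k F 0] by simp

lemma class_C_1_iff:
  "class_C 1 F \<longleftrightarrow>
    (\<forall>u. F differentiable (at u)) \<and> (\<forall>v. continuous_on UNIV (dir_deriv F v))"
  by simp

lemma class_C_const: "class_C k (\<lambda>u. c)"
  by (induction k arbitrary: c) auto

lemma class_C_inner: "class_C k (\<lambda>u. u \<bullet> a)"
proof (cases k)
  case (Suc m)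
  have "(\<lambda>u. u \<bullet> a) differentiable (at u)" for u
    by (auto simp: differentiable_def intro!: derivative_eq_intros)
  with Suc show ?thesis by (auto simp: class_C_const)
qed (auto intro!: continuous_intros)

lemma class_C_add:
  assumes "class_C k F" "class_C k G"
  shows "class_C k (\<lambda>u. F u + G u)"
  using assms
proof (induction k arbitrary: F G)
  case (Suc k)
  then have "dir_deriv (\<lambda>u. F u + G u) v = (\<lambda>u. dir_deriv F v u + dir_deriv G v u)" for v
    by (auto simp: dir_deriv_add)
  with Suc show ?case by auto
qed (auto intro!: continuous_intros)

lemma class_C_sum:
  assumes "\<And>i. i \<in> I \<Longrightarrow> class_C k (F i)"
  shows "class_C k (\<lambda>u. \<Sum>i\<in>I. F i u)"
  using assms
  by (induction I rule: infinite_finite_induct) (auto simp: class_C_const class_C_add)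

lemma class_C_mult:
  assumes "class_C k F" "class_C k G"
  shows "class_C k (\<lambda>u. F u * G u)"
  using assms
proof (induction k arbitrary: F G)
  case (Suc k)
  then have "dir_deriv (\<lambda>u. F u * G u) v =
      (\<lambda>u. F u * dir_deriv G v u + dir_deriv F v u * G u)" for v
    by (auto simp: dir_deriv_mult)
  moreover have "class_C k (\<lambda>u. F u * dir_deriv G v u + dir_deriv F v u * G u)" for v
    using Suc.prems Suc.prems[THEN class_C_SucD] by (intro class_C_add Suc.IH) auto
  ultimately show ?case
    using Suc.prems by auto
qed (auto intro!: continuous_intros)

text \<open>The outer function is given together with all its derivatives, because the chain rule
  replaces \<open>D m\<close> by \<open>D (Suc m)\<close>; with \<open>m\<close> generalised, the
  induction on \<open>k\<close> closes.\<close>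

lemma class_C_compose:
  assumes D: "\<And>m t. (D m has_real_derivative D (Suc m) t) (at t)"
    and "class_C k F"
  shows "class_C k (\<lambda>u. D m (F u))"
  using assms(2)
proof (induction k arbitrary: m F)
  case 0
  have "continuous_on UNIV (D m)"
    using D by (auto intro!: continuous_at_imp_continuous_on DERIV_isCont)
  with 0 show ?case
    by (auto intro: continuous_on_compose2)
next
  case (Suc k)
  then have "dir_deriv (\<lambda>u. D m (F u)) v = (\<lambda>u. D (Suc m) (F u) * dir_deriv F v u)" for v
    by (auto simp: dir_deriv_compose[OF D])
  moreover have "class_C k (\<lambda>u. D (Suc m) (F u) * dir_deriv F v u)" for v
    using Suc.prems Suc.prems[THEN class_C_SucD] by (intro class_C_mult Suc.IH) auto
  moreover have "(\<lambda>u. D m (F u)) differentiable (at u)" for u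
    using Suc.prems has_derivative_compose[OF has_derivative_dir_deriv[of F u]
        D[of m "F u", unfolded has_field_derivative_def]]
    by (auto simp: differentiable_def)
  ultimately show ?case by auto
qed

lemma class_C_exp:
  assumes "class_C k F"
  shows "class_C k (\<lambda>u. exp (F u))"
  using class_C_compose[of "\<lambda>m. exp" k F 0] assms by (auto intro: DERIV_exp)

lemma class_C_translate:
  assumes "class_C k F"
  shows "class_C k (\<lambda>u. F (u + a))"
  using assms
proof (induction k arbitrary: F)
  case 0
  then show ?case by (auto intro!: continuous_on_compose2[of UNIV F] continuous_intros)
next
  case (Suc k)
  have "((\<lambda>u. F (u + a)) has_derivative (\<lambda>v. dir_deriv F v (u + a))) (at u)" for u
    by (rule has_derivative_compose[of "\<lambda>u. u + a" "\<lambda>v. v"])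
       (use Suc.prems in \<open>auto intro!: derivative_eq_intros has_derivative_dir_deriv\<close>)
  then have "\<forall>u. (\<lambda>u. F (u + a)) differentiable (at u)"
    by (auto simp: differentiable_def)
  moreover have "dir_deriv (\<lambda>u. F (u + a)) v = (\<lambda>u. dir_deriv F v (u + a))" for v
    by (rule ext) (rule dir_deriv_translate)
  ultimately show ?case using Suc by auto
qed

text \<open>In finite dimension a set is bounded iff its closure is compact, so this is the support
  condition of \<open>test_function\<close>; in this form it passes easily to products, translates
  and derivatives.\<close>

abbreviation bounded_support :: "('a::real_normed_vector \<Rightarrow> real) \<Rightarrow> bool"
  where "bounded_support F \<equiv> bounded {u. F u \<noteq> 0}"

lemma bounded_supportD:
  assumes "bounded_support F"
  shows "\<exists>r\<ge>0. \<forall>u. norm u > r \<longrightarrow> F u = 0"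
proof -
  obtain r where "r > 0" "\<forall>u\<in>{u. F u \<noteq> 0}. norm u \<le> r"
    using assms by (meson bounded_pos)
  then show ?thesis by (intro exI[of _ r]) force
qed

lemma bounded_supportI:
  assumes "\<And>u. norm u > r \<Longrightarrow> F u = 0"
  shows "bounded_support F"
  using assms by (auto simp: bounded_iff intro!: exI[of _ r]) (meson not_le)

lemma bounded_support_mult_left: "bounded_support F \<Longrightarrow> bounded_support (\<lambda>u. F u * G u)"
  and bounded_support_mult_right: "bounded_support G \<Longrightarrow> bounded_support (\<lambda>u. F u * G u)"
  by (erule bounded_subset; auto)+

lemma bounded_support_translate:
  assumes "bounded_support F"
  shows "bounded_support (\<lambda>u. F (u + a))"
proof -
  have "{u. F (u + a) \<noteq> 0} = (\<lambda>u. u - a) ` {u. F u \<noteq> 0}"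
    by (auto simp: image_iff) (metis add_diff_cancel)
  then show ?thesis
    using assms by (simp add: bounded_translation_minus)
qed

lemma dir_deriv_cong:
  assumes "open S" "u \<in> S" "\<And>x. x \<in> S \<Longrightarrow> F x = G x"
  shows "dir_deriv F v u = dir_deriv G v u"
  unfolding dir_deriv_def
proof (rule deriv_cong_ev)
  have "((\<lambda>t::real. u + t *\<^sub>R v) \<longlongrightarrow> u + 0 *\<^sub>R v) (nhds 0)"
    by (intro tendsto_intros filterlim_ident)
  then have "\<forall>\<^sub>F t::real in nhds 0. u + t *\<^sub>R v \<in> S"
    using assms by (auto dest: topological_tendstoD)
  then show "\<forall>\<^sub>F t::real in nhds 0. F (u + t *\<^sub>R v) = G (u + t *\<^sub>R v)"
    by eventually_elim (rule assms)
qed simp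

text \<open>The strict inequality matters: the exterior of a closed ball is open, so
  \<open>F\<close> vanishes in a whole neighbourhood of \<open>u\<close>.\<close>

lemma dir_deriv_eq_0_outside:
  assumes "\<And>u. norm u > r \<Longrightarrow> F u = 0" "norm u > r"
  shows "dir_deriv F v u = 0"
proof -
  have "open {u::'a. norm u > r}"
    by (intro open_Collect_less continuous_intros)
  then have "dir_deriv F v u = dir_deriv (\<lambda>u. 0) v u"
    using assms by (intro dir_deriv_cong[of "{u. norm u > r}"]) auto
  then show ?thesis by simp
qed

lemma bounded_support_dir_deriv:
  assumes "bounded_support F"
  shows "bounded_support (dir_deriv F v)"
proof -
  obtain r where "r \<ge> 0" and r: "\<And>u. norm u > r \<Longrightarrow> F u = 0"
    using bounded_supportD[OF assms] by blast
  then show ?thesis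
    by (intro bounded_supportI[of r] dir_deriv_eq_0_outside[of r] r)
qed

lemma test_function_iff:
  "test_function F \<longleftrightarrow> (\<forall>k. class_C k F) \<and> bounded_support F"
  by (simp add: test_function_def)

lemma test_function_continuous: "test_function F \<Longrightarrow> continuous_on UNIV F"
  using class_C_continuous by (auto simp: test_function_iff)

text \<open>\<open>flat 1\<close> is the classical smooth function \<open>exp (- 1 / t)\<close>
  continued by zero. The polynomial factor makes the family closed under differentiation, so that
  smoothness needs only first derivatives.\<close>

definition flat :: "real poly \<Rightarrow> real \<Rightarrow> real"
  where "flat p t = (if t > 0 then poly p (1 / t) * exp (- (1 / t)) else 0)"

lemma poly_exp_tendsto_0: "((\<lambda>x. poly p x * exp (- x)) \<longlongrightarrow> (0::real)) at_top"
proof -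
  have "((\<lambda>x::real. \<Sum>i\<le>degree p. coeff p i * (x ^ i / exp x)) \<longlongrightarrow>
      (\<Sum>i\<le>degree p. coeff p i * 0)) at_top"
    by (intro tendsto_intros tendsto_power_div_exp_0)
  then show ?thesis
    by (simp add: poly_altdef sum_distrib_right exp_minus divide_inverse mult.assoc)
qed

lemma flat_tendsto_0: "(flat p \<longlongrightarrow> 0) (at 0)"
proof -
  have "((\<lambda>t. poly p (1 / t) * exp (- (1 / t))) \<longlongrightarrow> 0) (at_right 0)"
    using filterlim_compose[OF poly_exp_tendsto_0 filterlim_inverse_at_top_right]
    by (simp add: inverse_eq_divide)
  then have "(flat p \<longlongrightarrow> 0) (at_right 0)"
    by (rule Lim_transform_eventually)
       (auto simp: flat_def eventually_at_filter)
  moreover have "(flat p \<longlongrightarrow> 0) (at_left 0)"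
    by (rule Lim_transform_eventually[OF tendsto_const])
       (auto simp: flat_def eventually_at_filter)
  ultimately show ?thesis
    by (simp add: filterlim_split_at_real)
qed

text \<open>Both terms of the product rule carry the inner derivative of \<open>1 / t\<close>, of
  modulus \<open>1 / t^2\<close>; this is the factor \<open>[:0, 0, 1:]\<close>, and the sign of the
  inner derivative explains \<open>p - pderiv p\<close>.\<close>

lemma flat_has_derivative:
  "(flat p has_real_derivative flat ([:0, 0, 1:] * (p - pderiv p)) t) (at t)"
proof -
  consider "t > 0" | "t = 0" | "t < 0" by linarith
  then show ?thesis
  proof cases
    case 1
    have "((\<lambda>t. poly p (1 / t) * exp (- (1 / t))) has_real_derivative
        flat ([:0, 0, 1:] * (p - pderiv p)) t) (at t)"
      using 1 by (auto intro!: derivative_eq_intros DERIV_chain'[OF _ poly_DERIV]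
          simp: flat_def field_simps power2_eq_square)
    then show ?thesis
      by (rule has_field_derivative_transform_within_open[where S = "{0<..}"])
         (use 1 in \<open>auto simp: flat_def\<close>)
  next
    case 2
    \<comment> \<open>Division by \<open>t\<close> multiplies the polynomial by its variable, so the
      difference quotient at 0 is again a function of the family and tends to 0.\<close>
    have "((\<lambda>t. flat p t / t) \<longlongrightarrow> 0) (at 0)"
      using flat_tendsto_0[of "[:0, 1:] * p"]
      by (rule Lim_transform_eventually) (auto simp: flat_def eventually_at_filter)
    then show ?thesis
      using 2 by (simp add: DERIV_def flat_def)
  next
    case 3
    have "((\<lambda>t. 0) has_real_derivative flat ([:0, 0, 1:] * (p - pderiv p)) t) (at t)"
      using 3 by (simp add: flat_def)
    then show ?thesis
      by (rule has_field_derivative_transform_within_open[where S = "{..<0}"])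
         (use 3 in \<open>auto simp: flat_def\<close>)
  qed
qed

lemma class_C_flat:
  assumes "class_C k F"
  shows "class_C k (\<lambda>u. flat p (F u))"
proof -
  define D where "D m = flat (((\<lambda>p. [:0, 0, 1:] * (p - pderiv p)) ^^ m) p)" for m
  have "(D m has_real_derivative D (Suc m) t) (at t)" for m t
    unfolding D_def funpow.simps o_apply by (rule flat_has_derivative)
  then have "class_C k (\<lambda>u. D 0 (F u))"
    using assms by (rule class_C_compose)
  then show ?thesis by (simp add: D_def)
qed

section \<open>Differentiation under the integral sign\<close>

text \<open>Common ground for Lebesgue measure and the probability measure \<open>\<mu>\<close>:
  finiteness on balls makes every continuous function of bounded support integrable.\<close>

definition locally_finite_measure :: "'a::euclidean_space measure \<Rightarrow> bool"
  where "locally_finite_measure M \<longleftrightarrow>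
    sets M = sets borel \<and> (\<forall>r. emeasure M (cball 0 r) < \<infinity>)"

lemma locally_finite_lborel: "locally_finite_measure lborel"
  unfolding locally_finite_measure_def by (intro conjI allI emeasure_lborel_cball_finite) simp

lemma locally_finite_finite_measure:
  assumes "finite_measure M" "sets M = sets borel"
  shows "locally_finite_measure M"
  using assms by (simp add: locally_finite_measure_def finite_measure.emeasure_finite less_top[symmetric])

lemma continuous_bounded_on_cball:
  fixes g :: "'a::euclidean_space \<Rightarrow> real"
  assumes "continuous_on UNIV g"
  shows "\<exists>B\<ge>0. \<forall>u. norm u \<le> r \<longrightarrow> \<bar>g u\<bar> \<le> B"
proof -
  have "compact (g ` cball 0 r)"
    using assms by (intro compact_continuous_image continuous_on_subset[OF assms]) auto
  then obtain B where "B > 0" "\<forall>y\<in>g ` cball 0 r. norm y \<le> B"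
    by (meson compact_imp_bounded bounded_pos)
  then show ?thesis by (intro exI[of _ B]) auto
qed

lemma continuous_bounded_support_bounded:
  fixes g :: "'a::euclidean_space \<Rightarrow> real"
  assumes "continuous_on UNIV g" "bounded_support g"
  shows "\<exists>B\<ge>0. \<forall>u. \<bar>g u\<bar> \<le> B"
proof -
  obtain r where "r \<ge> 0" and r: "\<And>u. norm u > r \<Longrightarrow> g u = 0"
    using bounded_supportD[OF assms(2)] by blast
  obtain B where B: "B \<ge> 0" "\<And>u. norm u \<le> r \<Longrightarrow> \<bar>g u\<bar> \<le> B"
    using continuous_bounded_on_cball[OF assms(1)] by blast
  have "\<bar>g u\<bar> \<le> B" for u
    using B r[of u] by (cases "norm u \<le> r") auto
  with B(1) show ?thesis by blast
qed

context
  fixes M :: "'a::euclidean_space measure"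
  assumes M: "locally_finite_measure M"
begin

lemma integrable_cball_indicator: "integrable M (\<lambda>y. C * indicat_real (cball 0 r) y)"
  using M by (auto simp: locally_finite_measure_def intro!: integrable_real_indicator)

lemma continuous_measurable:
  fixes f :: "'a \<Rightarrow> real"
  assumes "continuous_on UNIV f"
  shows "f \<in> borel_measurable M"
  using borel_measurable_continuous_onI[OF assms] M
  by (simp add: locally_finite_measure_def cong: measurable_cong_sets)

lemma integrable_bounded_support:
  fixes f :: "'a \<Rightarrow> real"
  assumes f: "continuous_on UNIV f" "bounded_support f"
  shows "integrable M f"
proof -
  obtain r where "r \<ge> 0" and r: "\<And>u. norm u > r \<Longrightarrow> f u = 0"
    using bounded_supportD[OF f(2)] by blast
  obtain B where B: "B \<ge> 0" "\<And>u. \<bar>f u\<bar> \<le> B"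
    using continuous_bounded_support_bounded[OF f(1) f(2)] by blast
  show ?thesis
  proof (rule Bochner_Integration.integrable_bound[OF integrable_cball_indicator[of B r]])
    have "norm (f y) \<le> norm (B * indicat_real (cball 0 r) y)" for y
      using r[of y] B(2)[of y] by (cases "norm y \<le> r") auto
    then show "AE y in M. norm (f y) \<le> norm (B * indicat_real (cball 0 r) y)"
      by simp
  qed (rule continuous_measurable[OF f(1)])
qed

end

text \<open>Provides the domination for differentiating under the integral. The finitely many
  coordinate derivatives are continuous with bounded support, hence bounded; linearity in
  \<open>w\<close> gives the first bound and the mean value inequality the second.\<close>

lemma lipschitz_dir_deriv:
  fixes K :: "'a::euclidean_space \<Rightarrow> real"
  assumes K: "class_C 1 K" "bounded_support K"
  shows "\<exists>L\<ge>0. \<forall>x w. \<bar>dir_deriv K w x\<bar> \<le> L * norm w \<and> \<bar>K (x + w) - K x\<bar> \<le> L * norm w"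
proof -
  have "\<exists>B. B \<ge> 0 \<and> (\<forall>u. \<bar>dir_deriv K i u\<bar> \<le> B)" for i
    using continuous_bounded_support_bounded[of "dir_deriv K i"]
      K bounded_support_dir_deriv[OF K(2)] unfolding class_C_1_iff by metis
  then obtain B where B: "\<And>i. B i \<ge> 0" "\<And>i u. \<bar>dir_deriv K i u\<bar> \<le> B i"
    by metis
  define L where "L = (\<Sum>i\<in>Basis. B i)"
  have L: "\<bar>dir_deriv K w x\<bar> \<le> L * norm w" for w x
  proof -
    have lin: "linear (\<lambda>w. dir_deriv K w x)"
      using K(1) unfolding class_C_1_iff by (intro linear_dir_deriv) auto
    have "dir_deriv K w x = dir_deriv K (\<Sum>i\<in>Basis. (w \<bullet> i) *\<^sub>R i) x"
      by (simp only: euclidean_representation)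
    also have "\<dots> = (\<Sum>i\<in>Basis. (w \<bullet> i) * dir_deriv K i x)"
      by (simp add: linear_sum[OF lin] linear_scale[OF lin])
    also have "\<bar>\<dots>\<bar> \<le> (\<Sum>i\<in>Basis. norm w * B i)"
      by (intro order.trans[OF sum_abs] sum_mono)
         (auto simp: abs_mult intro!: mult_mono B Basis_le_norm)
    finally show ?thesis by (simp add: L_def sum_distrib_left mult.commute)
  qed
  have "norm (K (x + w) - K x) \<le> L * norm (x + w - x)" for x w
  proof (rule differentiable_bound[of UNIV])
    fix u
    show "(K has_derivative (\<lambda>v. dir_deriv K v u)) (at u)"
      using K(1) unfolding class_C_1_iff by (intro has_derivative_dir_deriv) auto
    show "onorm (\<lambda>v. dir_deriv K v u) \<le> L"
      by (rule onorm_le) (simp add: L)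
  qed auto
  with L show ?thesis
    by (intro exI[of _ L]) (auto simp: L_def intro: sum_nonneg B)
qed

text \<open>One ball carries the integrands for all \<open>u\<close> of norm at most
  \<open>N\<close>, which is what dominated convergence needs. The value \<open>s = 1\<close> serves
  translates, \<open>s = -1\<close> convolutions.\<close>

lemma bounded_support_parametric:
  fixes s :: real
  assumes K: "\<And>u. norm u > r \<Longrightarrow> K u = (0::real)" and s: "\<bar>s\<bar> = 1"
    and "norm u \<le> N" "norm y > r + N"
  shows "K (u + s *\<^sub>R y) = 0"
proof (rule K)
  have "norm (s *\<^sub>R y) - norm u \<le> norm (u + s *\<^sub>R y)"
    by (metis add.commute norm_diff_ineq)
  then show "norm (u + s *\<^sub>R y) > r"
    using assms by simp
qed

context
  fixes M :: "'a::euclidean_space measure" and g :: "'a \<Rightarrow> real" and s :: real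
  assumes M: "locally_finite_measure M"
    and g: "continuous_on UNIV g" and s: "\<bar>s\<bar> = 1"
begin

lemma integrable_parametric:
  assumes "continuous_on UNIV K" "bounded_support K"
  shows "integrable M (\<lambda>y. g y * K (u + s *\<^sub>R y))"
proof (rule integrable_bounded_support[OF M])
  show "continuous_on UNIV (\<lambda>y. g y * K (u + s *\<^sub>R y))"
    by (intro continuous_intros g continuous_on_compose2[OF assms(1)]) auto
  obtain r where "r \<ge> 0" and r: "\<And>u. norm u > r \<Longrightarrow> K u = 0"
    using bounded_supportD[OF assms(2)] by blast
  show "bounded_support (\<lambda>y. g y * K (u + s *\<^sub>R y))"
    using bounded_support_parametric[of r K s u "norm u", OF r s order_refl]
    by (intro bounded_supportI[of "r + norm u"]) simp
qed

lemma continuous_on_parametric: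
  assumes K: "continuous_on UNIV K" "bounded_support K"
  shows "continuous_on UNIV (\<lambda>u. \<integral>y. g y * K (u + s *\<^sub>R y) \<partial>M)"
proof (intro continuous_at_imp_continuous_on ballI continuous_at_sequentially[THEN iffD2] allI impI)
  fix u and X :: "nat \<Rightarrow> 'a"
  assume X: "X \<longlonglongrightarrow> u"
  then obtain N where N: "\<And>n. norm (X n) \<le> N"
    by (metis Bseq_def convergentI convergent_imp_Bseq)
  obtain r where "r \<ge> 0" and r: "\<And>u. norm u > r \<Longrightarrow> K u = 0"
    using bounded_supportD[OF K(2)] by blast
  obtain B where B: "B \<ge> 0" "\<And>u. \<bar>K u\<bar> \<le> B"
    using continuous_bounded_support_bounded[OF K(1) K(2)] by blast
  obtain C where C: "C \<ge> 0" "\<And>u. norm u \<le> r + N \<Longrightarrow> \<bar>g u\<bar> \<le> C"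
    using continuous_bounded_on_cball[OF g] by blast
  show "((\<lambda>u. \<integral>y. g y * K (u + s *\<^sub>R y) \<partial>M) \<circ> X) \<longlonglongrightarrow> (\<integral>y. g y * K (u + s *\<^sub>R y) \<partial>M)"
    unfolding o_def
  proof (rule integral_dominated_convergence)
    show "integrable M (\<lambda>y. (C * B) * indicat_real (cball 0 (r + N)) y)"
      by (rule integrable_cball_indicator[OF M])
    show "AE y in M. (\<lambda>n. g y * K (X n + s *\<^sub>R y)) \<longlonglongrightarrow> g y * K (u + s *\<^sub>R y)"
    proof (rule AE_I2)
      fix y
      have "(\<lambda>n. K (X n + s *\<^sub>R y)) \<longlonglongrightarrow> K (u + s *\<^sub>R y)"
        by (rule continuous_on_tendsto_compose[OF K(1)]) (auto intro!: tendsto_intros X)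
      then show "(\<lambda>n. g y * K (X n + s *\<^sub>R y)) \<longlonglongrightarrow> g y * K (u + s *\<^sub>R y)"
        by (rule tendsto_mult_left)
    qed
    show "AE y in M. norm (g y * K (X n + s *\<^sub>R y)) \<le> (C * B) * indicat_real (cball 0 (r + N)) y" for n
    proof (rule AE_I2)
      fix y
      show "norm (g y * K (X n + s *\<^sub>R y)) \<le> (C * B) * indicat_real (cball 0 (r + N)) y"
        using bounded_support_parametric[of r K s "X n" N y, OF r s N] B C(1) C(2)[of y]
        by (cases "norm y \<le> r + N") (auto simp: abs_mult intro!: mult_mono)
    qed
  qed (intro continuous_measurable[OF M] continuous_intros g continuous_on_compose2[OF K(1)]; simp)+
qed

text \<open>\<open>class_C\<close> asks for total differentiability, so the increments are arbitrary
  nonzero vectors tending to 0. Along such a sequence dominated convergence is applied to the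
  remainder divided by the norm of the increment.\<close>

lemma has_derivative_parametric:
  assumes K: "class_C 1 K" "bounded_support K"
  shows "((\<lambda>u. \<integral>y. g y * K (u + s *\<^sub>R y) \<partial>M) has_derivative
    (\<lambda>w. \<integral>y. g y * dir_deriv K w (u + s *\<^sub>R y) \<partial>M)) (at u)"
proof -
  have Kcont: "continuous_on UNIV K" and Kdiff: "\<And>u. K differentiable (at u)"
    and Kcont': "\<And>w. continuous_on UNIV (dir_deriv K w)"
    using K(1) class_C_continuous unfolding class_C_1_iff by (auto simp: class_C_continuous[OF K(1)])
  note Ksupp' = bounded_support_dir_deriv[OF K(2)]
  define I where "I u = (\<integral>y. g y * K (u + s *\<^sub>R y) \<partial>M)" for u
  define I' where "I' w = (\<integral>y. g y * dir_deriv K w (u + s *\<^sub>R y) \<partial>M)" for w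
  have int: "integrable M (\<lambda>y. g y * K (u + s *\<^sub>R y))" for u
    by (rule integrable_parametric[OF Kcont K(2)])
  have int': "integrable M (\<lambda>y. g y * dir_deriv K w (u + s *\<^sub>R y))" for w
    by (rule integrable_parametric[of "dir_deriv K w"]) (rule Kcont' Ksupp')+
  have "linear I'"
    unfolding I'_def
    by (rule linearI)
       (simp_all add: linear_add[OF linear_dir_deriv[OF Kdiff]]
         linear_scale[OF linear_dir_deriv[OF Kdiff]] distrib_left mult.left_commute[of "g _"] int')
  then have lin: "bounded_linear I'"
    by (simp add: linear_conv_bounded_linear)
  obtain r where "r \<ge> 0" and r: "\<And>u. norm u > r \<Longrightarrow> K u = 0"
    using bounded_supportD[OF K(2)] by blast
  obtain L where L: "L \<ge> 0" "\<And>x w. \<bar>dir_deriv K w x\<bar> \<le> L * norm w"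
    "\<And>x w. \<bar>K (x + w) - K x\<bar> \<le> L * norm w"
    using lipschitz_dir_deriv[OF K(1) K(2)] by blast
  have "((\<lambda>w. norm (I (u + w) - I u - I' w) / norm w) \<circ> X) \<longlonglongrightarrow> 0"
    if X0: "\<forall>n. X n \<in> UNIV - {0}" and X: "X \<longlonglongrightarrow> 0" for X
  proof -
    obtain N where N: "\<And>n. norm (X n) \<le> N"
      using X by (metis Bseq_def convergentI convergent_imp_Bseq)
    have N': "norm (u + X n) \<le> norm u + N" "norm u \<le> norm u + N" for n
      using norm_triangle_ineq[of u "X n"] N[of n] norm_ge_zero[of "X n"] by linarith+
    let ?R = "r + (norm u + N)"
    obtain C where C: "C \<ge> 0" "\<And>u. norm u \<le> ?R \<Longrightarrow> \<bar>g u\<bar> \<le> C"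
      using continuous_bounded_on_cball[OF g] by blast
    \<comment> \<open>The normalised first-order remainder of \<open>K\<close>; its integral against
      \<open>g\<close> is that of \<open>I\<close>. It is bounded by \<open>2 * L\<close>, one
      \<open>L\<close> for the increment of \<open>K\<close> and one for the linear term.\<close>
    define Q where "Q n y = (K (u + X n + s *\<^sub>R y) - K (u + s *\<^sub>R y)
        - dir_deriv K (X n) (u + s *\<^sub>R y)) / norm (X n)" for n y
    have "(\<lambda>n. \<integral>y. g y * Q n y \<partial>M) \<longlonglongrightarrow> (\<integral>y. 0 \<partial>M)"
    proof (rule integral_dominated_convergence)
      show "integrable M (\<lambda>y. (C * (2 * L)) * indicat_real (cball 0 ?R) y)"
        by (rule integrable_cball_indicator[OF M])
      show "AE y in M. (\<lambda>n. g y * Q n y) \<longlonglongrightarrow> 0"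
      proof (rule AE_I2)
        fix y
        have "((\<lambda>w. norm (K ((u + s *\<^sub>R y) + w) - K (u + s *\<^sub>R y) - dir_deriv K w (u + s *\<^sub>R y)) / norm w)
            \<longlongrightarrow> 0) (at 0)"
          using has_derivative_dir_deriv[OF Kdiff, of "u + s *\<^sub>R y"] unfolding has_derivative_at by blast
        then have "(\<lambda>n. norm (K ((u + s *\<^sub>R y) + X n) - K (u + s *\<^sub>R y)
            - dir_deriv K (X n) (u + s *\<^sub>R y)) / norm (X n)) \<longlonglongrightarrow> 0"
          using X0 X unfolding tendsto_at_iff_sequentially o_def by blast
        then have "(\<lambda>n. norm (Q n y)) \<longlonglongrightarrow> 0"
          by (simp add: Q_def algebra_simps)
        then have "(\<lambda>n. Q n y) \<longlonglongrightarrow> 0"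
          by (rule tendsto_norm_zero_cancel)
        then show "(\<lambda>n. g y * Q n y) \<longlonglongrightarrow> 0"
          by (rule tendsto_mult_right_zero)
      qed
      show "AE y in M. norm (g y * Q n y) \<le> (C * (2 * L)) * indicat_real (cball 0 ?R) y" for n
      proof (rule AE_I2)
        fix y
        have "\<bar>K (u + s *\<^sub>R y + X n) - K (u + s *\<^sub>R y) - dir_deriv K (X n) (u + s *\<^sub>R y)\<bar>
            \<le> 2 * L * norm (X n)"
          using L(2)[of "X n" "u + s *\<^sub>R y"] L(3)[of "u + s *\<^sub>R y" "X n"] by linarith
        then have "\<bar>Q n y\<bar> \<le> 2 * L"
          using X0 by (simp add: Q_def field_simps)
        moreover have "Q n y = 0" if "norm y > ?R"
        proof -
          have "dir_deriv K (X n) (u + s *\<^sub>R y) = 0"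
            by (rule bounded_support_parametric[of r "dir_deriv K (X n)", OF dir_deriv_eq_0_outside s N'(2) that])
               (use r in auto)
          then show ?thesis
            using bounded_support_parametric[of r K, OF r s N'(1) that]
              bounded_support_parametric[of r K, OF r s N'(2) that]
            by (simp add: Q_def)
        qed
        ultimately show "norm (g y * Q n y) \<le> (C * (2 * L)) * indicat_real (cball 0 ?R) y"
          using C(1) C(2)[of y] L(1)
          by (cases "norm y \<le> ?R") (auto simp: abs_mult intro!: mult_mono)
      qed
      show "(\<lambda>y. g y * Q n y) \<in> borel_measurable M" for n
        unfolding Q_def using X0
        by (intro continuous_measurable[OF M] continuous_intros g continuous_on_compose2[OF Kcont]
            continuous_on_compose2[OF Kcont']) auto
    qed simp
    moreover have "(\<integral>y. g y * Q n y \<partial>M) = (I (u + X n) - I u - I' (X n)) / norm (X n)" for n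
      unfolding I_def I'_def Q_def
      using int[of "u + X n"] int[of u] int'[of "X n"]
      by (simp add: right_diff_distrib diff_divide_distrib)
    ultimately have "(\<lambda>n. (I (u + X n) - I u - I' (X n)) / norm (X n)) \<longlonglongrightarrow> 0"
      by simp
    then show ?thesis
      using tendsto_norm_zero by (fastforce simp: o_def)
  qed
  then have "(I has_derivative I') (at u)"
    using lin unfolding has_derivative_at tendsto_at_iff_sequentially by blast
  then show ?thesis
    by (simp add: I_def[abs_def] I'_def[abs_def])
qed

end

context
  fixes M :: "'a::euclidean_space measure" and g :: "'a \<Rightarrow> real" and s :: real
  assumes M: "locally_finite_measure M"
    and g: "continuous_on UNIV g" and s: "\<bar>s\<bar> = 1"
begin

lemma dir_deriv_parametric:
  assumes "class_C 1 K" "bounded_support K"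
  shows "dir_deriv (\<lambda>u. \<integral>y. g y * K (u + s *\<^sub>R y) \<partial>M) w =
    (\<lambda>u. \<integral>y. g y * dir_deriv K w (u + s *\<^sub>R y) \<partial>M)"
  by (rule ext, rule dir_deriv_eq[OF has_derivative_parametric[OF M g s assms]])

lemma class_C_parametric:
  assumes "class_C k K" "bounded_support K"
  shows "class_C k (\<lambda>u. \<integral>y. g y * K (u + s *\<^sub>R y) \<partial>M)"
  using assms
proof (induction k arbitrary: K)
  case 0
  then show ?case using continuous_on_parametric[OF M g s] by simp
next
  case (Suc k)
  then have K: "class_C 1 K"
    using class_C_mono by (metis One_nat_def Suc_le_mono le0)
  have "\<forall>u. (\<lambda>u. \<integral>y. g y * K (u + s *\<^sub>R y) \<partial>M) differentiable (at u)"
    using has_derivative_parametric[OF M g s K Suc.prems(2)] by (auto simp: differentiable_def)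
  with Suc show ?case
    by (simp add: dir_deriv_parametric[OF K Suc.prems(2)] bounded_support_dir_deriv)
qed

lemma test_function_parametric:
  assumes "test_function K" "bounded_support g"
  shows "test_function (\<lambda>u. \<integral>y. g y * K (u + s *\<^sub>R y) \<partial>M)"
proof -
  have K: "\<And>k. class_C k K" "bounded_support K"
    using assms by (auto simp: test_function_iff)
  obtain r where r: "\<And>u. norm u > r \<Longrightarrow> K u = 0"
    using bounded_supportD[OF K(2)] by blast
  obtain N where N: "\<And>u. norm u > N \<Longrightarrow> g u = 0"
    using bounded_supportD[OF assms(2)] by blast
  have "g y * K (u + s *\<^sub>R y) = 0" if "norm u > r + N" for u y
  proof (cases "norm y > N")
    case False
    have "norm u - norm (s *\<^sub>R y) \<le> norm (u + s *\<^sub>R y)"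
      by (rule norm_diff_ineq)
    then have "norm (u + s *\<^sub>R y) > r"
      using that False s by simp
    with r show ?thesis by simp
  qed (simp add: N)
  then have "bounded_support (\<lambda>u. \<integral>y. g y * K (u + s *\<^sub>R y) \<partial>M)"
    by (intro bounded_supportI[of "r + N"]) (simp only: Bochner_Integration.integral_zero)
  with K show ?thesis
    by (simp add: test_function_iff class_C_parametric)
qed

end

lemma lborel_integral_translate:
  fixes f :: "'a::euclidean_space \<Rightarrow> real"
  assumes "continuous_on UNIV f"
  shows "(\<integral>y. f (a + y) \<partial>lborel) = (\<integral>y. f y \<partial>lborel)"
proof -
  have "(\<integral>y. f y \<partial>lborel) = (\<integral>y. f y \<partial>distr lborel borel ((+) a))"
    by (simp only: lborel_distr_plus)
  also have "\<dots> = (\<integral>y. f (a + y) \<partial>lborel)"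
    by (rule integral_distr) (auto intro: borel_measurable_continuous_onI[OF assms])
  finally show ?thesis ..
qed

section \<open>Mollification\<close>

text \<open>Evenness is what turns the translates \<open>g (u + y)\<close> in \<open>average\<close>
  into a genuine convolution, see \<open>average_eq_convolution\<close>.\<close>

definition mollifier :: "real \<Rightarrow> ('a::euclidean_space \<Rightarrow> real) \<Rightarrow> bool"
  where "mollifier r \<rho> \<longleftrightarrow> test_function \<rho> \<and> (\<forall>x. \<rho> x \<ge> 0) \<and> (\<forall>x. norm x > r \<longrightarrow> \<rho> x = 0) \<and>
    (\<forall>x. \<rho> (- x) = \<rho> x) \<and> (\<integral>x. \<rho> x \<partial>lborel) = 1"

lemma mollifier_exists:
  assumes "r > 0"
  shows "\<exists>\<rho>::'a::euclidean_space \<Rightarrow> real. mollifier r \<rho>"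
proof -
  \<comment> \<open>The square of the norm is expanded in coordinates, so that the argument of
    \<open>flat\<close> is built from sums and products of inner products with fixed
    vectors.\<close>
  define \<eta> :: "'a \<Rightarrow> real" where "\<eta> x = flat 1 (r\<^sup>2 + (\<Sum>i\<in>Basis. (-1) * ((x \<bullet> i) * (x \<bullet> i))))" for x
  have \<eta>: "\<eta> x = flat 1 (r\<^sup>2 - (norm x)\<^sup>2)" for x
    by (simp add: \<eta>_def sum_negf power2_norm_eq_inner euclidean_inner[symmetric])
  have outside: "\<eta> x = 0" if "norm x > r" for x
    using that assms by (simp add: \<eta> flat_def power_mono less_imp_le not_less)
  have pos: "\<eta> x > 0" if "norm x < r" for x
    using that assms by (simp add: \<eta> flat_def power_strict_mono)
  have nonneg: "\<eta> x \<ge> 0" for x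
    by (simp add: \<eta> flat_def)
  have C: "class_C k \<eta>" for k
    unfolding \<eta>_def[abs_def]
    by (intro class_C_flat class_C_add class_C_sum class_C_mult class_C_const class_C_inner)
  have supp: "bounded_support \<eta>"
    using outside by (rule bounded_supportI)
  define c where "c = (\<integral>x. \<eta> x \<partial>lborel)"
  have "c \<noteq> 0"
  proof
    assume "c = 0"
    then have "AE x in lborel. \<eta> x = 0"
      unfolding c_def
      using integral_nonneg_eq_0_iff_AE[OF integrable_bounded_support[OF locally_finite_lborel
            class_C_continuous[OF C] supp]] nonneg by simp
    then have "AE x in lborel. x \<notin> ball (0::'a) r"
    proof eventually_elim
      case (elim x)
      with pos[of x] show ?case by auto
    qed
    then have "ball (0::'a) r \<in> null_sets lborel"
      by (subst AE_iff_null_sets) auto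
    then show False
      using content_ball_pos[OF assms, of "0::'a"] by (simp add: null_sets_def measure_def)
  qed
  moreover have "c \<ge> 0"
    unfolding c_def by (simp add: nonneg)
  ultimately have c: "c > 0" by simp
  define \<rho> where "\<rho> x = inverse c * \<eta> x" for x
  have "class_C k \<rho>" for k
    unfolding \<rho>_def[abs_def] by (intro class_C_mult class_C_const C)
  moreover have "bounded_support \<rho>"
    unfolding \<rho>_def by (intro bounded_support_mult_right supp)
  ultimately have "mollifier r \<rho>"
    using c nonneg outside
    by (simp add: mollifier_def test_function_iff \<rho>_def) (simp add: c_def[symmetric] \<eta>)
  then show ?thesis by blast
qed

text \<open>In this form differentiation under the integral puts derivatives on \<open>g\<close>, so
  averaging commutes with derivatives of C^1 functions. The convolution form puts them on
  \<open>\<rho>\<close>, so averages of merely continuous functions are smooth.\<close>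

definition average :: "('a::euclidean_space \<Rightarrow> real) \<Rightarrow> ('a \<Rightarrow> real) \<Rightarrow> 'a \<Rightarrow> real"
  where "average \<rho> g u = (\<integral>y. \<rho> y * g (u + y) \<partial>lborel)"

context
  fixes r :: real and \<rho> :: "'a::euclidean_space \<Rightarrow> real"
  assumes \<rho>: "mollifier r \<rho>"
begin

lemma mollifier_facts:
  shows "test_function \<rho>" "\<rho> x \<ge> 0" "norm x > r \<Longrightarrow> \<rho> x = 0" "\<rho> (- x) = \<rho> x"
    "(\<integral>x. \<rho> x \<partial>lborel) = 1" "continuous_on UNIV \<rho>" "bounded_support \<rho>" "integrable lborel \<rho>"
proof -
  show *: "continuous_on UNIV \<rho>" "bounded_support \<rho>"
    using \<rho> class_C_continuous[of 0 \<rho>] unfolding mollifier_def test_function_iff by blast+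
  show "integrable lborel \<rho>"
    by (rule integrable_bounded_support[OF locally_finite_lborel *])
qed (use \<rho> in \<open>auto simp: mollifier_def\<close>)

text \<open>Both the uniform bound and the convergence of mollifications are instances of this estimate.\<close>

lemma average_dist_le:
  assumes g: "continuous_on UNIV g" and "\<And>y. norm y \<le> r \<Longrightarrow> \<bar>g (u + y) - c\<bar> \<le> B"
  shows "\<bar>average \<rho> g u - c\<bar> \<le> B"
proof -
  have int: "integrable lborel (\<lambda>y. \<rho> y * g (u + y))"
    by (intro integrable_bounded_support[OF locally_finite_lborel] bounded_support_mult_left
        mollifier_facts continuous_intros continuous_on_compose2[OF g]) auto
  have "average \<rho> g u - c = (\<integral>y. \<rho> y * g (u + y) \<partial>lborel) - (\<integral>y. \<rho> y * c \<partial>lborel)"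
    by (simp add: average_def mollifier_facts)
  also have "\<dots> = (\<integral>y. \<rho> y * (g (u + y) - c) \<partial>lborel)"
    using int mollifier_facts(8) by (simp add: right_diff_distrib)
  also have "\<bar>\<dots>\<bar> \<le> (\<integral>y. \<rho> y * B \<partial>lborel)"
  proof (rule integral_abs_bound[THEN order_trans], rule integral_mono)
    show "integrable lborel (\<lambda>y. \<bar>\<rho> y * (g (u + y) - c)\<bar>)"
      using int mollifier_facts(8) by (simp add: right_diff_distrib)
    show "\<bar>\<rho> y * (g (u + y) - c)\<bar> \<le> \<rho> y * B" for y
      using assms(2)[of y] mollifier_facts(2,3)[of y]
      by (cases "norm y \<le> r") (auto simp: abs_mult intro: mult_left_mono)
  qed (simp add: mollifier_facts)
  finally show ?thesis by (simp add: mollifier_facts)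
qed

lemma average_eq_const:
  assumes "continuous_on UNIV g" "\<And>y. norm y \<le> r \<Longrightarrow> g (u + y) = c"
  shows "average \<rho> g u = c"
  using average_dist_le[of g u c 0] assms by simp

lemma average_eq_convolution:
  assumes g: "continuous_on UNIV g"
  shows "average \<rho> g u = (\<integral>y. g y * \<rho> (u + (- 1) *\<^sub>R y) \<partial>lborel)"
proof -
  have "average \<rho> g u = (\<integral>y. \<rho> (- u + (u + y)) * g (u + y) \<partial>lborel)"
    by (simp add: average_def)
  also have "\<dots> = (\<integral>y. \<rho> (- u + y) * g y \<partial>lborel)"
    by (rule lborel_integral_translate)
       (intro continuous_intros continuous_on_compose2[OF mollifier_facts(6)] g; simp)
  finally show ?thesis
    using mollifier_facts(4)[of "u - _"] by (simp add: mult.commute)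
qed

lemma test_function_average:
  assumes "continuous_on UNIV g" "bounded_support g"
  shows "test_function (average \<rho> g)"
  unfolding average_eq_convolution[OF assms(1), abs_def]
  by (intro test_function_parametric locally_finite_lborel assms mollifier_facts) simp

lemma dir_deriv_average:
  assumes "class_C 1 g" "bounded_support g"
  shows "dir_deriv (average \<rho> g) v = average \<rho> (dir_deriv g v)"
  using dir_deriv_parametric[OF locally_finite_lborel mollifier_facts(6) _ assms, of 1 v]
  by (simp add: average_def[abs_def])

lemma average_outside:
  assumes g: "continuous_on UNIV g" and "\<And>u. norm u > R \<Longrightarrow> g u = 0" "norm u > R + r"
  shows "average \<rho> g u = 0"
proof (rule average_eq_const[OF g])
  fix y :: 'a
  assume "norm y \<le> r"
  then have "norm (u + y) > R"
    using norm_diff_ineq[of u y] assms(3) by linarith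
  then show "g (u + y) = 0" by (rule assms(2))
qed

end

text \<open>Pointwise convergence suffices, since the later limits are taken by dominated
  convergence with the bound from \<open>average_bounded\<close>.\<close>

lemma average_tendsto:
  assumes g: "continuous_on UNIV g"
    and \<rho>: "\<And>k. mollifier (1 / Suc k) (\<rho> k)"
  shows "(\<lambda>k. average (\<rho> k) g u) \<longlonglongrightarrow> g u"
proof (rule metric_LIMSEQ_I)
  fix \<epsilon> :: real
  assume "\<epsilon> > 0"
  moreover have "continuous (at u) g"
    using g by (simp add: continuous_on_eq_continuous_at)
  \<comment> \<open>Half of \<open>\<epsilon>\<close>, because \<open>average_dist_le\<close> yields
    only a non-strict inequality.\<close>
  ultimately obtain d where d: "d > 0" "\<And>x. dist x u < d \<Longrightarrow> dist (g x) (g u) < \<epsilon> / 2"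
    unfolding continuous_at_eps_delta by (meson half_gt_zero)
  obtain N where N: "1 / Suc N < d"
    using d(1) by (meson nat_approx_posE)
  have "dist (average (\<rho> k) g u) (g u) < \<epsilon>" if "k \<ge> N" for k
  proof -
    have "1 / Suc k \<le> 1 / Suc N"
      using that by (simp add: field_simps)
    with N have "1 / Suc k < d" by linarith
    then have "\<bar>average (\<rho> k) g u - g u\<bar> \<le> \<epsilon> / 2"
      using d(2)[of "u + _"]
      by (intro average_dist_le[OF \<rho> g]) (simp add: dist_norm less_imp_le)
    with \<open>\<epsilon> > 0\<close> show ?thesis by (simp add: dist_real_def)
  qed
  then show "\<exists>N. \<forall>k\<ge>N. dist (average (\<rho> k) g u) (g u) < \<epsilon>" by blast
qed

lemma average_bounded:
  assumes "continuous_on UNIV g" "mollifier r \<rho>" "\<And>u. \<bar>g u\<bar> \<le> B"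
  shows "\<bar>average \<rho> g u\<bar> \<le> B"
  using average_dist_le[OF assms(2,1), of u 0 B] assms(3) by simp

lemma mollifier_sequence:
  obtains \<rho> :: "nat \<Rightarrow> 'a::euclidean_space \<Rightarrow> real" where "\<And>k. mollifier (1 / Suc k) (\<rho> k)"
proof -
  have "\<exists>\<rho>::'a \<Rightarrow> real. mollifier (1 / Suc k) \<rho>" for k
    by (rule mollifier_exists) simp
  then show ?thesis using that by metis
qed

lemma cutoff_exists:
  "\<exists>\<theta>::'a::euclidean_space \<Rightarrow> real. test_function \<theta> \<and> (\<forall>u. norm u < R \<longrightarrow> \<theta> u = 1)"
proof -
  obtain \<rho> :: "'a \<Rightarrow> real" where \<rho>: "mollifier 1 \<rho>"
    using mollifier_exists[of 1] by auto
  \<comment> \<open>Equal to 1 up to radius \<open>R + 1\<close>, so that averaging over the unit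
    ball leaves the value 1 on the ball of radius \<open>R\<close>.\<close>
  define p :: "'a \<Rightarrow> real" where "p u = max 0 (min 1 (R + 2 - norm u))" for u
  have p: "continuous_on UNIV p"
    unfolding p_def by (intro continuous_intros)
  moreover have "bounded_support p"
    by (rule bounded_supportI[of "R + 2"]) (simp add: p_def)
  ultimately have "test_function (average \<rho> p)"
    by (rule test_function_average[OF \<rho>])
  moreover have "average \<rho> p u = 1" if "norm u < R" for u
  proof (rule average_eq_const[OF \<rho> p])
    fix y :: 'a
    assume "norm y \<le> 1"
    then have "norm (u + y) \<le> R + 1"
      using that norm_triangle_ineq[of u y] by linarith
    then show "p (u + y) = 1" by (simp add: p_def)
  qed
  ultimately show ?thesis by blast
qed

section \<open>The Gibbs measure satisfies the KMS condition\<close>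

lemma class_C_1_continuous_dir_deriv: "class_C 1 F \<Longrightarrow> continuous_on UNIV (dir_deriv F v)"
  and class_C_1_differentiable: "class_C 1 F \<Longrightarrow> F differentiable (at u)"
  by simp_all

text \<open>The integral of \<open>F (u + y)\<close> over \<open>y\<close> does not depend on
  \<open>u\<close>; differentiating it under the integral at \<open>u = 0\<close> gives the
  claim.\<close>

lemma integral_dir_deriv_eq_0:
  assumes "class_C 1 F" "bounded_support F"
  shows "(\<integral>y. dir_deriv F v y \<partial>lborel) = 0"
proof -
  have "(\<integral>y. dir_deriv F v y \<partial>lborel) =
      dir_deriv (\<lambda>u. \<integral>y. 1 * F (u + 1 *\<^sub>R y) \<partial>lborel) v 0"
    by (subst dir_deriv_parametric[OF locally_finite_lborel _ _ assms]) simp_all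
  also have "(\<lambda>u. \<integral>y. 1 * F (u + 1 *\<^sub>R y) \<partial>lborel) = (\<lambda>u. \<integral>y. F y \<partial>lborel)"
    using lborel_integral_translate[OF class_C_continuous[OF assms(1)]] by simp
  finally show ?thesis by simp
qed

text \<open>
  For \<open>F\<close> of class \<open>C\<^sup>2\<close> this is two integrations by parts and the symmetry of the second derivative.
  Instead, \<open>J\<close> below is differentiated at \<open>0\<close> in two ways.
\<close>

lemma integral_dir_deriv_swap:
  assumes F: "class_C 1 F" "bounded_support F" and K: "class_C 1 K" "bounded_support K"
  shows "(\<integral>y. dir_deriv F a y * dir_deriv K b y \<partial>lborel) =
    (\<integral>y. dir_deriv F b y * dir_deriv K a y \<partial>lborel)"
proof -
  note cont = class_C_continuous[OF F(1)] class_C_continuous[OF K(1)]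
    class_C_1_continuous_dir_deriv[OF F(1)] class_C_1_continuous_dir_deriv[OF K(1)]
  define J where "J u = (\<integral>y. dir_deriv K b y * F (u + 1 *\<^sub>R y) \<partial>lborel)" for u
  define H where "H u = (\<integral>y. dir_deriv F b y * K (u + 1 *\<^sub>R y) \<partial>lborel)" for u
  \<comment> \<open>A single integration by parts along \<open>b\<close>, followed by a shift of the
    variable. Differentiating along \<open>a\<close> then acts on \<open>F\<close> in one expression
    and on \<open>K\<close> in the other, so only first derivatives occur.\<close>
  have J: "J u = - H (- u)" for u
  proof -
    have Fu: "class_C 1 (\<lambda>y. F (y + u))" "bounded_support (\<lambda>y. F (y + u))"
        by (rule class_C_translate[OF F(1)], rule bounded_support_translate[OF F(2)])
    have int: "integrable lborel (\<lambda>y. F (y + u) * dir_deriv K b y)"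
      "integrable lborel (\<lambda>y. dir_deriv F b (y + u) * K y)"
      by (intro integrable_bounded_support[OF locally_finite_lborel] bounded_support_mult_right
          bounded_support_dir_deriv K continuous_intros cont continuous_on_compose2[of UNIV F]
          continuous_on_compose2[of UNIV "dir_deriv F b"]; simp)+
    have "0 = (\<integral>y. dir_deriv (\<lambda>y. F (y + u) * K y) b y \<partial>lborel)"
      by (intro integral_dir_deriv_eq_0[symmetric] class_C_mult Fu K bounded_support_mult_right)
    also have "\<dots> = (\<integral>y. F (y + u) * dir_deriv K b y + dir_deriv F b (y + u) * K y \<partial>lborel)"
      by (simp only: dir_deriv_mult[OF class_C_1_differentiable[OF Fu(1)]
            class_C_1_differentiable[OF K(1)]] dir_deriv_translate)
    also have "\<dots> = J u + (\<integral>y. dir_deriv F b (u + y) * K (- u + (u + y)) \<partial>lborel)"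
      using int by (simp add: J_def add.commute mult.commute)
    also have "(\<integral>y. dir_deriv F b (u + y) * K (- u + (u + y)) \<partial>lborel) = H (- u)"
      unfolding H_def
      by (subst lborel_integral_translate)
         (auto intro!: continuous_intros cont continuous_on_compose2[of UNIV K])
    finally show ?thesis by simp
  qed
  have "(H has_derivative (\<lambda>w. \<integral>y. dir_deriv F b y * dir_deriv K w (- 0 + 1 *\<^sub>R y) \<partial>lborel)) (at (- 0))"
    unfolding H_def[abs_def]
    by (intro has_derivative_parametric locally_finite_lborel cont K) simp
  then have "((\<lambda>u. - H (- u)) has_derivative
      (\<lambda>w. - (\<integral>y. dir_deriv F b y * dir_deriv K (- w) (- 0 + 1 *\<^sub>R y) \<partial>lborel))) (at 0)"
    by (intro has_derivative_minus has_derivative_compose[of uminus uminus 0 UNIV H])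
       (auto intro!: derivative_eq_intros)
  then have J1: "(J has_derivative
      (\<lambda>w. \<integral>y. dir_deriv F b y * dir_deriv K w y \<partial>lborel)) (at 0)"
    by (simp add: J[abs_def] linear_neg[OF linear_dir_deriv[OF class_C_1_differentiable[OF K(1)]]])
  have "(J has_derivative
      (\<lambda>w. \<integral>y. dir_deriv K b y * dir_deriv F w (0 + 1 *\<^sub>R y) \<partial>lborel)) (at 0)"
    unfolding J_def[abs_def]
    by (intro has_derivative_parametric locally_finite_lborel cont F) simp
  from dir_deriv_eq[OF this, of a] dir_deriv_eq[OF J1, of a] show ?thesis
    by (simp add: mult.commute)
qed

section \<open>Poisson brackets of C^1 functions and the Gibbs weight\<close>

lemma continuous_on_poisson_bracket:
  assumes "class_C 1 F" "class_C 1 G"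
  shows "continuous_on UNIV (poisson_bracket n e F G)"
  unfolding poisson_bracket_def[abs_def]
  by (intro continuous_intros class_C_1_continuous_dir_deriv assms)

lemma bounded_support_poisson_bracket:
  assumes "bounded_support F"
  shows "bounded_support (poisson_bracket n e F G)"
proof -
  obtain r where r: "\<And>u. norm u > r \<Longrightarrow> F u = 0"
    using bounded_supportD[OF assms] by blast
  show ?thesis
    by (rule bounded_supportI[of r]) (simp add: poisson_bracket_def dir_deriv_eq_0_outside[OF r])
qed

text \<open>In the application \<open>K\<close> is \<open>G\<close> times the Gibbs weight, hence
  only C^1. Each summand integrates to zero by \<open>integral_dir_deriv_swap\<close>.\<close>

lemma integral_poisson_bracket_eq_0:
  assumes F: "class_C 1 F" "bounded_support F" and K: "class_C 1 K" "bounded_support K"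
  shows "(\<integral>u. poisson_bracket n e F K u \<partial>lborel) = 0"
proof -
  have int: "integrable lborel (\<lambda>u. dir_deriv F a u * dir_deriv K b u)" for a b
    by (intro integrable_bounded_support[OF locally_finite_lborel] bounded_support_mult_right
        bounded_support_dir_deriv K continuous_intros class_C_1_continuous_dir_deriv F)
  have int': "integrable lborel (\<lambda>u. dir_deriv K a u * dir_deriv F b u)" for a b
    using int[of b a] by (simp add: mult.commute)
  have "(\<integral>u. dir_deriv K a u * dir_deriv F b u \<partial>lborel) =
      (\<integral>u. dir_deriv F a u * dir_deriv K b u \<partial>lborel)" for a b
    using integral_dir_deriv_swap[OF F K, of b a] by (simp add: mult.commute)
  then show ?thesis
    by (simp add: poisson_bracket_def int int' Bochner_Integration.integral_sum)
qed

lemma poisson_bracket_mult_right: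
  assumes "G differentiable (at u)" "K differentiable (at u)"
  shows "poisson_bracket n e F (\<lambda>u. G u * K u) u =
    poisson_bracket n e F G u * K u + G u * poisson_bracket n e F K u"
  unfolding poisson_bracket_def dir_deriv_mult[OF assms] sum_distrib_left sum_distrib_right
    sum.distrib[symmetric]
  by (intro sum.cong refl) (simp add: algebra_simps)

lemma dir_deriv_exp_scaled:
  assumes "h differentiable (at u)"
  shows "dir_deriv (\<lambda>u. exp (c * h u)) v u = c * exp (c * h u) * dir_deriv h v u"
proof (rule dir_deriv_compose[OF _ assms])
  show "((\<lambda>t. exp (c * t)) has_real_derivative c * exp (c * h u)) (at (h u))"
    by (auto intro!: derivative_eq_intros)
qed

lemma class_C_exp_scaled:
  assumes "class_C k h"
  shows "class_C k (\<lambda>u. exp (c * h u))"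
  by (intro class_C_exp class_C_mult class_C_const assms)

lemma poisson_bracket_exp_scaled:
  assumes "h differentiable (at u)"
  shows "poisson_bracket n e F (\<lambda>u. exp (c * h u)) u = c * exp (c * h u) * poisson_bracket n e F h u"
  unfolding poisson_bracket_def dir_deriv_exp_scaled[OF assms] sum_distrib_left
  by (intro sum.cong refl) (simp add: algebra_simps)

text \<open>A positive function with zero integral would make the whole space a null set. This
  excludes a division by zero in \<open>gibbs_measure\<close>.\<close>

lemma partition_function_nonzero:
  fixes h :: "'a::euclidean_space \<Rightarrow> real"
  assumes "continuous_on UNIV h"
  shows "partition_function \<beta> h \<noteq> 0"
proof
  assume "partition_function \<beta> h = 0"
  moreover have "(\<lambda>u. ennreal (exp (- \<beta> * h u))) \<in> borel_measurable lborel"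
    by (rule measurable_compose[OF _ measurable_ennreal], rule continuous_measurable[OF locally_finite_lborel])
       (intro continuous_intros assms)
  ultimately have "AE u::'a in lborel. False"
    unfolding partition_function_def by (subst (asm) nn_integral_0_iff_AE) (auto simp: not_le)
  then have "(UNIV :: 'a set) \<in> null_sets lborel"
    by (subst AE_iff_null_sets) auto
  then show False
    by (simp add: null_sets_def emeasure_lborel_UNIV)
qed

lemma gibbs_measure_eq_density:
  fixes h :: "'a::euclidean_space \<Rightarrow> real"
  assumes "continuous_on UNIV h" "partition_function \<beta> h < \<infinity>"
  shows "gibbs_measure \<beta> h =
    density lborel (\<lambda>u. ennreal (exp (- \<beta> * h u) / enn2real (partition_function \<beta> h)))"
proof -
  have "enn2real (partition_function \<beta> h) > 0"
    using partition_function_nonzero[OF assms(1)] assms(2)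
    by (simp add: enn2real_positive_iff zero_less_iff_neq_zero)
  moreover have "ennreal (enn2real (partition_function \<beta> h)) = partition_function \<beta> h"
    using assms(2) by simp
  ultimately have "ennreal (exp (- \<beta> * h u)) / partition_function \<beta> h =
      ennreal (exp (- \<beta> * h u) / enn2real (partition_function \<beta> h))" for u
    by (metis divide_ennreal exp_ge_zero)
  then show ?thesis
    by (simp add: gibbs_measure_def)
qed

lemma KMS_gibbs:
  fixes h :: "'a::hermitian_space \<Rightarrow> real"
  assumes h: "class_C 1 h" and Z: "partition_function \<beta> h < \<infinity>"
  shows "KMS_condition n e \<beta> h (gibbs_measure \<beta> h)"
  unfolding KMS_condition_def
proof (intro allI impI)
  fix F G :: "'a \<Rightarrow> real"
  assume "test_function F" "test_function G"
  then have F: "class_C 1 F" "bounded_support F" and G: "class_C 1 G" "bounded_support G"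
    unfolding test_function_iff by blast+
  let ?z = "enn2real (partition_function \<beta> h)"
  let ?w = "\<lambda>u. exp (- \<beta> * h u)"
  let ?PG = "poisson_bracket n e F G" and ?Ph = "poisson_bracket n e F h"
  note cont = class_C_continuous[OF h] class_C_continuous[OF G(1)]
    continuous_on_poisson_bracket[OF F(1) G(1)] continuous_on_poisson_bracket[OF F(1) h]
  have gibbs: "(\<integral>u. f u \<partial>gibbs_measure \<beta> h) = (\<integral>u. ?w u * f u \<partial>lborel) / ?z"
    if "continuous_on UNIV f" for f
    unfolding gibbs_measure_eq_density[OF cont(1) Z]
    by (subst integral_density)
       (use borel_measurable_continuous_onI[OF that] borel_measurable_continuous_onI[OF cont(1)]
         in \<open>auto simp: divide_inverse mult.assoc mult.left_commute[of _ "inverse _"]\<close>)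
  have int: "integrable lborel (\<lambda>u. ?w u * ?PG u)" "integrable lborel (\<lambda>u. ?w u * (?Ph u * G u))"
    by (intro integrable_bounded_support[OF locally_finite_lborel] bounded_support_mult_right
        bounded_support_poisson_bracket F G continuous_intros cont)+
  have "0 = (\<integral>u. poisson_bracket n e F (\<lambda>u. G u * ?w u) u \<partial>lborel)"
    by (intro integral_poisson_bracket_eq_0[symmetric] F class_C_mult G class_C_exp_scaled h
        bounded_support_mult_left)
  also have "\<dots> = (\<integral>u. ?w u * ?PG u - \<beta> * (?w u * (?Ph u * G u)) \<partial>lborel)"
  proof (intro Bochner_Integration.integral_cong refl)
    fix u
    have "?w differentiable (at u)"
      by (intro class_C_1_differentiable class_C_exp_scaled h)
    then have "poisson_bracket n e F (\<lambda>u. G u * ?w u) u =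
        ?PG u * ?w u + G u * (- \<beta> * ?w u * ?Ph u)"
      by (simp only: poisson_bracket_mult_right[OF class_C_1_differentiable[OF G(1)]]
          poisson_bracket_exp_scaled[OF class_C_1_differentiable[OF h]])
    then show "poisson_bracket n e F (\<lambda>u. G u * ?w u) u = ?w u * ?PG u - \<beta> * (?w u * (?Ph u * G u))"
      by (simp add: algebra_simps)
  qed
  also have "\<dots> = (\<integral>u. ?w u * ?PG u \<partial>lborel) - \<beta> * (\<integral>u. ?w u * (?Ph u * G u) \<partial>lborel)"
    using int by simp
  finally show "(\<integral>u. ?PG u \<partial>gibbs_measure \<beta> h) = \<beta> * (\<integral>u. ?Ph u * G u \<partial>gibbs_measure \<beta> h)"
    by (simp add: gibbs cont continuous_on_mult)
qed

section \<open>Uniqueness of the KMS state\<close>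

lemma scaleC_zero_right: "a *\<^sub>C 0 = (0 :: 'a::hermitian_space)"
  using scaleC_add_right[of a 0 "0::'a"] by simp

lemma scaleC_sum_right:
  "a *\<^sub>C (\<Sum>i\<in>I. f i) = (\<Sum>i\<in>I. a *\<^sub>C (f i :: 'a::hermitian_space))"
  by (induction I rule: infinite_finite_induct) (auto simp: scaleC_zero_right scaleC_add_right)

lemma cinner_zero_left: "cinner (0 :: 'a::hermitian_space) y = 0"
  using cinner_add_left[of "0::'a" 0 y] by simp

lemma cinner_sum_left:
  "cinner (\<Sum>i\<in>I. f i :: 'a::hermitian_space) y = (\<Sum>i\<in>I. cinner (f i) y)"
  by (induction I rule: infinite_finite_induct) (auto simp: cinner_zero_left cinner_add_left)

lemma cinner_scaleC_right:
  "cinner x (a *\<^sub>C y) = cnj a * cinner x (y :: 'a::hermitian_space)"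
  by (metis cinner_commute cinner_scaleC_left complex_cnj_mult)

lemma scaleC_decompose:
  "a *\<^sub>C x = Re a *\<^sub>R x + Im a *\<^sub>R (\<i> *\<^sub>C (x :: 'a::hermitian_space))"
proof -
  have "a = complex_of_real (Re a) + complex_of_real (Im a) * \<i>"
    by (simp add: complex_eq_iff)
  then have "a *\<^sub>C x = complex_of_real (Re a) *\<^sub>C x + complex_of_real (Im a) *\<^sub>C \<i> *\<^sub>C x"
    by (metis scaleC_add_left scaleC_scaleC)
  then show ?thesis by (simp only: scaleC_of_real)
qed

text \<open>The terms are arranged as in \<open>poisson_bracket\<close>: if \<open>a\<close> is the
  gradient of \<open>F\<close>, the two real inner products are the derivatives of \<open>F\<close>
  along \<open>e j\<close> and \<open>\<i> *\<^sub>C e j\<close>. They are the real and imaginary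
  parts of the complex coefficients of \<open>a\<close>.\<close>

lemma unitary_basis_expansion:
  fixes a :: "'a::hermitian_space"
  assumes "unitary_basis n e"
  shows "\<i> *\<^sub>C a = (\<Sum>j=1..n. (e j \<bullet> a) *\<^sub>R (\<i> *\<^sub>C e j) - ((\<i> *\<^sub>C e j) \<bullet> a) *\<^sub>R e j)"
proof -
  obtain c where c: "a = (\<Sum>j=1..n. c j *\<^sub>C e j)"
    using assms unfolding unitary_basis_def by blast
  have coeff: "cinner a (e k) = c k" if "k \<in> {1..n}" for k
  proof -
    have "cinner a (e k) = (\<Sum>j=1..n. c j * cinner (e j) (e k))"
      by (simp add: c cinner_sum_left cinner_scaleC_left)
    also have "\<dots> = (\<Sum>j=1..n. if j = k then c j else 0)"
      using assms that by (intro sum.cong) (auto simp: unitary_basis_def)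
    finally show ?thesis using that by simp
  qed
  have "\<i> *\<^sub>C a = (\<Sum>j=1..n. (\<i> * c j) *\<^sub>C e j)"
    by (simp add: c scaleC_sum_right scaleC_scaleC)
  also have "\<dots> = (\<Sum>j=1..n. (e j \<bullet> a) *\<^sub>R (\<i> *\<^sub>C e j) - ((\<i> *\<^sub>C e j) \<bullet> a) *\<^sub>R e j)"
  proof (rule sum.cong)
    fix j
    assume "j \<in> {1..n}"
    then have "e j \<bullet> a = Re (c j)" "(\<i> *\<^sub>C e j) \<bullet> a = Im (c j)"
      unfolding inner_commute[of "e j" a] inner_commute[of "\<i> *\<^sub>C e j" a]
      by (simp_all add: inner_eq_Re_cinner cinner_scaleC_right coeff)
    then show "(\<i> * c j) *\<^sub>C e j = (e j \<bullet> a) *\<^sub>R (\<i> *\<^sub>C e j) - ((\<i> *\<^sub>C e j) \<bullet> a) *\<^sub>R e j"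
      by (subst scaleC_decompose) simp
  qed simp
  finally show ?thesis .
qed

text \<open>The vector \<open>a\<close> is the gradient of \<open>F\<close> at \<open>u\<close>, so \<open>\<i> a\<close> is its Hamiltonian vector field.\<close>

lemma poisson_bracket_eq_dir_deriv:
  assumes "unitary_basis n e" "\<And>w. dir_deriv F w u = w \<bullet> a" "G differentiable (at u)"
  shows "poisson_bracket n e F G u = dir_deriv G (\<i> *\<^sub>C a) u"
proof -
  note lin = linear_dir_deriv[OF assms(3)]
  show ?thesis
    unfolding unitary_basis_expansion[OF assms(1), of a] poisson_bracket_def assms(2)
    by (simp add: linear_sum[OF lin] linear_diff[OF lin] linear_scale[OF lin] mult.commute)
qed

section \<open>Integration by parts and translation invariance for a KMS state\<close>

lemma KMS_integration_by_parts:
  fixes h :: "'a::hermitian_space \<Rightarrow> real"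
  assumes e: "unitary_basis n e" and KMS: "KMS_condition n e \<beta> h \<mu>"
    and h: "class_C 1 h" and G: "test_function G"
  shows "(\<integral>u. dir_deriv G v u \<partial>\<mu>) = \<beta> * (\<integral>u. dir_deriv h v u * G u \<partial>\<mu>)"
proof -
  have G1: "class_C 1 G" "bounded_support G"
    using G unfolding test_function_iff by blast+
  obtain r where r: "\<And>u. norm u > r \<Longrightarrow> G u = 0"
    using bounded_supportD[OF G1(2)] by blast
  \<comment> \<open>The margin 1 makes two open regions cover the space: for
    \<open>norm u < r + 1\<close> the function \<open>F\<close> below is linear, and for
    \<open>norm u > r\<close> the function \<open>G\<close> and its derivatives vanish.\<close>
  obtain \<theta> :: "'a \<Rightarrow> real" where \<theta>: "test_function \<theta>" "\<And>u. norm u < r + 1 \<Longrightarrow> \<theta> u = 1"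
    using cutoff_exists by blast
  \<comment> \<open>The bracket with a function of gradient \<open>a\<close> differentiates along
    \<open>\<i> *\<^sub>C a\<close>, which has to be \<open>v\<close>.\<close>
  define a where "a = (- \<i>) *\<^sub>C v"
  have a: "\<i> *\<^sub>C a = v"
    using scaleC_of_real[of 1 v] by (simp add: a_def scaleC_scaleC)
  define F where "F u = \<theta> u * (u \<bullet> a)" for u
  have F: "test_function F"
    using \<theta>(1) unfolding F_def[abs_def] test_function_iff
    by (intro conjI allI class_C_mult class_C_inner bounded_support_mult_left) auto
  have bracket: "poisson_bracket n e F K u = dir_deriv K v u"
    if "norm u < r + 1" "K differentiable (at u)" for K u
  proof -
    have "open {u::'a. norm u < r + 1}"
      by (intro open_Collect_less continuous_intros)
    then have "dir_deriv F w u = dir_deriv (\<lambda>u. u \<bullet> a) w u" for w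
      using that(1) by (intro dir_deriv_cong[of "{u. norm u < r + 1}"]) (auto simp: F_def \<theta>(2))
    then show ?thesis
      using poisson_bracket_eq_dir_deriv[OF e _ that(2), of F a] a by simp
  qed
  have "poisson_bracket n e F G = dir_deriv G v"
  proof
    fix u
    show "poisson_bracket n e F G u = dir_deriv G v u"
    proof (cases "norm u < r + 1")
      case False
      then have "norm u > r" by simp
      then show ?thesis
        by (simp add: poisson_bracket_def dir_deriv_eq_0_outside[OF r])
    qed (simp add: bracket class_C_1_differentiable[OF G1(1)])
  qed
  moreover have "poisson_bracket n e F h u * G u = dir_deriv h v u * G u" for u
    by (cases "norm u < r + 1") (simp_all add: r bracket class_C_1_differentiable[OF h])
  moreover have "(\<integral>u. poisson_bracket n e F G u \<partial>\<mu>) = \<beta> * (\<integral>u. poisson_bracket n e F h u * G u \<partial>\<mu>)"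
    using KMS F G unfolding KMS_condition_def by blast
  ultimately show ?thesis by (simp only:)
qed

text \<open>Averages of \<open>G\<close> are test functions, and averaging commutes with the
  derivative along \<open>v\<close>, so both sides of the identity for averages converge to those
  for \<open>G\<close>.\<close>

lemma KMS_integration_by_parts_C1:
  fixes h :: "'a::hermitian_space \<Rightarrow> real"
  assumes e: "unitary_basis n e" and KMS: "KMS_condition n e \<beta> h \<mu>"
    and \<mu>: "locally_finite_measure \<mu>"
    and h: "class_C 1 h" and G: "class_C 1 G" "bounded_support G"
  shows "(\<integral>u. dir_deriv G v u \<partial>\<mu>) = \<beta> * (\<integral>u. dir_deriv h v u * G u \<partial>\<mu>)"
proof -
  obtain \<rho> :: "nat \<Rightarrow> 'a \<Rightarrow> real" where \<rho>: "\<And>k. mollifier (1 / Suc k) (\<rho> k)"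
    using mollifier_sequence by blast
  note Gcont = class_C_continuous[OF G(1)] class_C_1_continuous_dir_deriv[OF G(1)]
  \<comment> \<open>Used on the left with \<open>w = 1\<close> and the derivative of
    \<open>G\<close>, on the right with the derivative of \<open>h\<close> and \<open>G\<close>
    itself. The weight \<open>w\<close> may be unbounded, but as \<open>1 / Suc k\<close> is at most
    1, all averages vanish outside the ball of radius \<open>r + 1\<close>.\<close>
  have lim: "(\<lambda>k. \<integral>u. w u * average (\<rho> k) g u \<partial>\<mu>) \<longlonglongrightarrow> (\<integral>u. w u * g u \<partial>\<mu>)"
    if g: "continuous_on UNIV g" "bounded_support g" and w: "continuous_on UNIV w" for w g
  proof -
    obtain r where r: "\<And>u. norm u > r \<Longrightarrow> g u = 0"
      using bounded_supportD[OF g(2)] by blast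
    obtain B where B: "B \<ge> 0" "\<And>u. \<bar>g u\<bar> \<le> B"
      using continuous_bounded_support_bounded[OF g] by blast
    obtain C where C: "C \<ge> 0" "\<And>u. norm u \<le> r + 1 \<Longrightarrow> \<bar>w u\<bar> \<le> C"
      using continuous_bounded_on_cball[OF w] by blast
    show ?thesis
    proof (rule integral_dominated_convergence)
      show "integrable \<mu> (\<lambda>y. (C * B) * indicat_real (cball 0 (r + 1)) y)"
        by (rule integrable_cball_indicator[OF \<mu>])
      show "AE u in \<mu>. (\<lambda>k. w u * average (\<rho> k) g u) \<longlonglongrightarrow> w u * g u"
        by (intro AE_I2 tendsto_mult_left average_tendsto[OF g(1) \<rho>])
      show "AE u in \<mu>. norm (w u * average (\<rho> k) g u) \<le> (C * B) * indicat_real (cball 0 (r + 1)) u" for k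
      proof (rule AE_I2)
        fix u
        show "norm (w u * average (\<rho> k) g u) \<le> (C * B) * indicat_real (cball 0 (r + 1)) u"
        proof (cases "norm u \<le> r + 1")
          case False
          moreover have "1 / real (Suc k) \<le> 1" by simp
          ultimately have "norm u > r + 1 / real (Suc k)" by linarith
          then show ?thesis
            using average_outside[OF \<rho> g(1) r] False by simp
        next
          case True
          then show ?thesis
            using C B average_bounded[OF g(1) \<rho> B(2)] by (auto simp: abs_mult intro!: mult_mono)
        qed
      qed
      show "(\<lambda>u. w u * average (\<rho> k) g u) \<in> borel_measurable \<mu>" for k
        by (intro continuous_measurable[OF \<mu>] continuous_intros w test_function_continuous
            test_function_average[OF \<rho>] g)
    qed (intro continuous_measurable[OF \<mu>] continuous_intros w g)
  qed
  have "(\<integral>u. dir_deriv (average (\<rho> k) G) v u \<partial>\<mu>) =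
      \<beta> * (\<integral>u. dir_deriv h v u * average (\<rho> k) G u \<partial>\<mu>)" for k
    by (intro KMS_integration_by_parts[OF e KMS h] test_function_average[OF \<rho>] Gcont G)
  then have "(\<integral>u. 1 * average (\<rho> k) (dir_deriv G v) u \<partial>\<mu>) =
      \<beta> * (\<integral>u. dir_deriv h v u * average (\<rho> k) G u \<partial>\<mu>)" for k
    by (simp add: dir_deriv_average[OF \<rho> G])
  moreover have "(\<lambda>k. \<integral>u. 1 * average (\<rho> k) (dir_deriv G v) u \<partial>\<mu>) \<longlonglongrightarrow> (\<integral>u. 1 * dir_deriv G v u \<partial>\<mu>)"
    by (intro lim Gcont bounded_support_dir_deriv G continuous_intros)
  moreover have "(\<lambda>k. \<beta> * (\<integral>u. dir_deriv h v u * average (\<rho> k) G u \<partial>\<mu>)) \<longlonglongrightarrow>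
      \<beta> * (\<integral>u. dir_deriv h v u * G u \<partial>\<mu>)"
    by (intro tendsto_mult_left lim Gcont G class_C_1_continuous_dir_deriv h)
  ultimately show ?thesis
    by (simp add: LIMSEQ_unique)
qed

text \<open>The left side, as a function of \<open>u\<close>, has derivative zero: in the
  integration by parts for the weight times a translate of \<open>\<phi>\<close>, the term in which
  the weight is differentiated cancels the right-hand side exactly.\<close>

lemma KMS_translation_invariant:
  fixes h :: "'a::hermitian_space \<Rightarrow> real"
  assumes e: "unitary_basis n e" and KMS: "KMS_condition n e \<beta> h \<mu>"
    and \<mu>: "locally_finite_measure \<mu>"
    and h: "class_C 1 h" and \<phi>: "class_C 1 \<phi>" "bounded_support \<phi>"
  shows "(\<integral>y. exp (\<beta> * h y) * \<phi> (u + y) \<partial>\<mu>) = (\<integral>y. exp (\<beta> * h y) * \<phi> y \<partial>\<mu>)"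
proof -
  let ?E = "\<lambda>y. exp (\<beta> * h y)"
  have E: "class_C 1 ?E" by (intro class_C_exp_scaled h)
  define T where "T u = (\<integral>y. ?E y * \<phi> (u + 1 *\<^sub>R y) \<partial>\<mu>)" for u
  have zero: "(\<integral>y. ?E y * dir_deriv \<phi> w (u + 1 *\<^sub>R y) \<partial>\<mu>) = 0" for u w
  proof -
    have \<phi>u: "class_C 1 (\<lambda>y. \<phi> (y + u))" "bounded_support (\<lambda>y. \<phi> (y + u))"
      by (rule class_C_translate[OF \<phi>(1)], rule bounded_support_translate[OF \<phi>(2)])
    let ?D = "\<lambda>y. dir_deriv h w y * (?E y * \<phi> (y + u))"
    have int: "integrable \<mu> (\<lambda>y. ?E y * dir_deriv (\<lambda>y. \<phi> (y + u)) w y)" "integrable \<mu> ?D"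
      by (intro integrable_bounded_support[OF \<mu>] bounded_support_mult_right bounded_support_dir_deriv
          \<phi>u continuous_intros class_C_continuous[OF E] class_C_1_continuous_dir_deriv h
          class_C_continuous[OF \<phi>u(1)])+
    have "(\<integral>y. dir_deriv (\<lambda>y. ?E y * \<phi> (y + u)) w y \<partial>\<mu>) = \<beta> * (\<integral>y. ?D y \<partial>\<mu>)"
      by (intro KMS_integration_by_parts_C1[OF e KMS \<mu> h] class_C_mult E \<phi>u bounded_support_mult_right)
    moreover have "dir_deriv (\<lambda>y. ?E y * \<phi> (y + u)) w y =
        ?E y * dir_deriv (\<lambda>y. \<phi> (y + u)) w y + \<beta> * ?D y" for y
      by (simp only: dir_deriv_mult[OF class_C_1_differentiable[OF E] class_C_1_differentiable[OF \<phi>u(1)]]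
          dir_deriv_exp_scaled[OF class_C_1_differentiable[OF h]])
         (simp add: algebra_simps)
    ultimately show ?thesis
      using int by (simp add: dir_deriv_translate add.commute)
  qed
  have "(T has_derivative (\<lambda>w. 0)) (at x)" for x
    using has_derivative_parametric[OF \<mu> class_C_continuous[OF E] _ \<phi>, of 1 x]
    by (simp add: zero[simplified] T_def[abs_def])
  then have "T u = T 0"
    by (intro has_derivative_zero_unique[of UNIV T]) auto
  then show ?thesis by (simp add: T_def)
qed

section \<open>Identification with Lebesgue measure\<close>

lemma Fubini_continuous:
  fixes f :: "'a::euclidean_space \<Rightarrow> 'a \<Rightarrow> real"
  assumes M: "locally_finite_measure M" "sigma_finite_measure M"
    and N: "locally_finite_measure N" "sigma_finite_measure N"
    and f: "continuous_on UNIV (\<lambda>(x, y). f x y)"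
    and f0: "\<And>x y. norm x > r \<or> norm y > r \<Longrightarrow> f x y = 0"
  shows "(\<integral>y. \<integral>x. f x y \<partial>M \<partial>N) = (\<integral>x. \<integral>y. f x y \<partial>N \<partial>M)"
proof -
  interpret M: sigma_finite_measure M by fact
  interpret N: sigma_finite_measure N by fact
  interpret pair_sigma_finite M N ..
  have sets: "sets M = sets borel" "sets N = sets borel"
    and fin: "emeasure M (cball 0 s) < \<infinity>" "emeasure N (cball 0 s) < \<infinity>" for s
    using M(1) N(1) by (auto simp: locally_finite_measure_def)
  \<comment> \<open>The product measure is again finite on balls, since a ball of the product space
    lies in a product of balls; this makes the kernel integrable for it.\<close>
  have "sets (M \<Otimes>\<^sub>M N) = sets borel"
    by (subst borel_prod[symmetric]) (rule sets_pair_measure_cong[OF sets])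
  moreover have "emeasure (M \<Otimes>\<^sub>M N) (cball 0 s) < \<infinity>" for s
  proof -
    have "cball 0 s \<subseteq> cball (0::'a) s \<times> cball (0::'a) s"
      by (auto intro: order_trans[OF norm_fst_le] order_trans[OF norm_snd_le])
    then have "emeasure (M \<Otimes>\<^sub>M N) (cball 0 s) \<le> emeasure (M \<Otimes>\<^sub>M N) (cball 0 s \<times> cball 0 s)"
      by (intro emeasure_mono) (auto simp: sets)
    also have "\<dots> = emeasure M (cball 0 s) * emeasure N (cball 0 s)"
      by (intro N.emeasure_pair_measure_Times) (auto simp: sets)
    also have "\<dots> < \<infinity>"
      using fin by (simp add: ennreal_mult_less_top)
    finally show ?thesis .
  qed
  ultimately have "locally_finite_measure (M \<Otimes>\<^sub>M N)"
    by (simp add: locally_finite_measure_def)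
  moreover have "bounded_support (\<lambda>(x, y). f x y)"
  proof (rule bounded_subset)
    show "{p. (case p of (x, y) \<Rightarrow> f x y) \<noteq> 0} \<subseteq> cball 0 r \<times> cball 0 r"
      using f0 by (force simp: not_less[symmetric])
  qed (intro bounded_Times bounded_cball)
  ultimately have "integrable (M \<Otimes>\<^sub>M N) (\<lambda>(x, y). f x y)"
    using f by (intro integrable_bounded_support)
  then show ?thesis by (rule Fubini_integral)
qed

text \<open>The uniqueness argument for Haar measure: the double integral of
  \<open>\<rho> x * (exp (\<beta> * h y) * \<phi> (x + y))\<close> is evaluated twice, by invariance
  applied to \<open>\<phi>\<close>, and, after a substitution, by invariance applied to
  \<open>\<rho>\<close>.\<close>

lemma KMS_eq_lebesgue_integral:
  fixes h :: "'a::hermitian_space \<Rightarrow> real"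
  assumes e: "unitary_basis n e" and KMS: "KMS_condition n e \<beta> h \<mu>"
    and \<mu>: "prob_space \<mu>" "sets \<mu> = sets borel" and h: "class_C 1 h"
  shows "\<exists>c\<ge>0. \<forall>\<phi>. class_C 1 \<phi> \<longrightarrow> bounded_support \<phi> \<longrightarrow>
    (\<integral>y. exp (\<beta> * h y) * \<phi> y \<partial>\<mu>) = c * (\<integral>y. \<phi> y \<partial>lborel)"
proof -
  interpret prob_space \<mu> by fact
  have sf: "sigma_finite_measure \<mu>" "sigma_finite_measure (lborel :: 'a measure)"
    by unfold_locales
  have lf: "locally_finite_measure \<mu>"
    using \<mu>(2) by (intro locally_finite_finite_measure) unfold_locales
  let ?E = "\<lambda>y. exp (\<beta> * h y)"
  note E = class_C_continuous[OF class_C_exp_scaled[OF h]]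
  obtain \<rho> :: "'a \<Rightarrow> real" where \<rho>: "mollifier 1 \<rho>"
    using mollifier_exists[of 1] by auto
  note \<rho>_facts = mollifier_facts[OF \<rho>]
  have \<rho>1: "class_C 1 \<rho>"
    using \<rho>_facts(1) unfolding test_function_iff by blast
  define c where "c = (\<integral>y. ?E y * \<rho> y \<partial>\<mu>)"
  have "c \<ge> 0"
    unfolding c_def by (simp add: \<rho>_facts(2))
  moreover have "(\<integral>y. ?E y * \<phi> y \<partial>\<mu>) = c * (\<integral>y. \<phi> y \<partial>lborel)"
    if \<phi>: "class_C 1 \<phi>" "bounded_support \<phi>" for \<phi>
  proof -
    obtain r where r: "r \<ge> 0" "\<And>u. norm u > r \<Longrightarrow> \<phi> u = 0"
      using bounded_supportD[OF \<phi>(2)] by blast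
    note cont = E class_C_continuous[OF \<phi>(1)] \<rho>_facts(6)
    have "(\<integral>y. ?E y * \<phi> y \<partial>\<mu>) = (\<integral>x. \<rho> x * (\<integral>y. ?E y * \<phi> y \<partial>\<mu>) \<partial>lborel)"
      by (simp add: \<rho>_facts(5))
    also have "\<dots> = (\<integral>x. \<integral>y. \<rho> x * (?E y * \<phi> (x + y)) \<partial>\<mu> \<partial>lborel)"
      by (simp add: KMS_translation_invariant[OF e KMS lf h \<phi>])
    \<comment> \<open>The radius \<open>r + 1\<close> adds the radii of the balls carrying
      \<open>\<phi>\<close> and \<open>\<rho>\<close>: for larger \<open>y\<close>, the points
      \<open>x\<close> and \<open>x + y\<close> cannot both lie in their balls.\<close>
    also have "\<dots> = (\<integral>y. \<integral>x. \<rho> x * (?E y * \<phi> (x + y)) \<partial>lborel \<partial>\<mu>)"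
    proof (rule Fubini_continuous[OF lf sf(1) locally_finite_lborel sf(2)])
      show "continuous_on UNIV (\<lambda>(y, x). \<rho> x * (?E y * \<phi> (x + y)))"
        unfolding split_beta
        by (intro continuous_intros continuous_on_compose2[OF cont(1)]
            continuous_on_compose2[OF cont(2)] continuous_on_compose2[OF cont(3)]) auto
      fix x y :: 'a
      assume "norm y > r + 1 \<or> norm x > r + 1"
      moreover have "norm x > 1 \<or> norm (x + y) > r" if "norm y > r + 1"
        using that norm_diff_ineq[of y x] by (auto simp: add.commute not_less)
      ultimately have "norm x > 1 \<or> norm (x + y) > r"
        using r(1) by linarith
      then show "\<rho> x * (?E y * \<phi> (x + y)) = 0"
        using \<rho>_facts(3) r(2) by auto
    qed
    also have "\<dots> = (\<integral>y. ?E y * average \<rho> \<phi> y \<partial>\<mu>)"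
      by (simp add: average_def mult.left_commute[of "\<rho> _"] add.commute)
    \<comment> \<open>The substitution \<open>z = x + y\<close> in the inner integral. Now
      \<open>\<rho>\<close> is translated by \<open>- z\<close>, and invariance can be used a second
      time.\<close>
    also have "\<dots> = (\<integral>y. \<integral>z. \<phi> z * (?E y * \<rho> (- z + y)) \<partial>lborel \<partial>\<mu>)"
      by (simp add: average_eq_convolution[OF \<rho> cont(2)] mult.left_commute[of "\<phi> _"])
    also have "\<dots> = (\<integral>z. \<integral>y. \<phi> z * (?E y * \<rho> (- z + y)) \<partial>\<mu> \<partial>lborel)"
    proof (rule Fubini_continuous[OF locally_finite_lborel sf(2) lf sf(1)])
      show "continuous_on UNIV (\<lambda>(z, y). \<phi> z * (?E y * \<rho> (- z + y)))"
        unfolding split_beta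
        by (intro continuous_intros continuous_on_compose2[OF cont(1)]
            continuous_on_compose2[OF cont(2)] continuous_on_compose2[OF cont(3)]) auto
      fix z y :: 'a
      assume "norm z > r + 1 \<or> norm y > r + 1"
      moreover have "norm z > r \<or> norm (- z + y) > 1" if "norm y > r + 1"
        using that norm_diff_ineq[of y "- z"] by (auto simp: add.commute not_less)
      ultimately have "norm z > r \<or> norm (- z + y) > 1"
        by linarith
      then show "\<phi> z * (?E y * \<rho> (- z + y)) = 0"
        using \<rho>_facts(3) r(2) by auto
    qed
    also have "\<dots> = (\<integral>z. \<phi> z * c \<partial>lborel)"
      by (simp only: integral_mult_right_zero c_def
          KMS_translation_invariant[OF e KMS lf h \<rho>1 \<rho>_facts(7), of "- _"])
    finally show ?thesis by (simp add: mult.commute)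
  qed
  ultimately show ?thesis by blast
qed

text \<open>Boxes generate the Borel sets, and the indicator of a bounded open set \<open>X\<close>
  is the limit of the truncated multiples of the distance to its complement, which are continuous
  and vanish off \<open>X\<close>.\<close>

lemma finite_measure_eqI_continuous:
  fixes M N :: "'a::euclidean_space measure"
  assumes M: "finite_measure M" "sets M = sets borel" and N: "finite_measure N" "sets N = sets borel"
    and eq: "\<And>f. continuous_on UNIV f \<Longrightarrow> bounded_support f \<Longrightarrow> (\<integral>x. f x \<partial>M) = (\<integral>x. f x \<partial>N)"
  shows "M = N"
proof (rule measure_eqI_generator_eq)
  interpret M: finite_measure M by fact
  interpret N: finite_measure N by fact
  let ?boxes = "range (\<lambda>(a, b). box a b :: 'a set)"
  show "Int_stable ?boxes"
    by (auto simp: Int_stable_def box_Int_box)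
  show "sets M = sigma_sets UNIV ?boxes" "sets N = sigma_sets UNIV ?boxes"
    by (simp_all add: M N borel_eq_box)
  show "range (\<lambda>k. box (- real k *\<^sub>R One) (real k *\<^sub>R One)) \<subseteq> ?boxes"
    by auto
  show "(\<Union>k. box (- real k *\<^sub>R One) (real k *\<^sub>R One)) = (UNIV :: 'a set)"
    by (simp add: UN_box_eq_UNIV)
  show "emeasure M (box (- real k *\<^sub>R One) (real k *\<^sub>R One)) \<noteq> \<infinity>" for k
    by simp
  fix X
  assume "X \<in> ?boxes"
  then have X: "open X" "bounded X" by auto
  \<comment> \<open>By convention \<open>infdist\<close> to the empty set is 0, which would make the
    functions \<open>f k\<close> below vanish identically.\<close>
  then have "- X \<noteq> {}"
    by (metis Compl_empty_eq double_complement not_bounded_UNIV)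
  define f where "f k x = min 1 (real k * infdist x (- X))" for k x
  have f_cont: "continuous_on UNIV (f k)" for k
    unfolding f_def by (intro continuous_intros)
  have f_out: "f k x = 0" if "x \<notin> X" for k x
    using that by (simp add: f_def)
  have f_supp: "bounded_support (f k)" for k
    using f_out by (intro bounded_subset[OF X(2)]) auto
  have f_le: "norm (f k x) \<le> 1" for k x
    by (simp add: f_def infdist_nonneg)
  have f_lim: "(\<lambda>k. f k x) \<longlonglongrightarrow> indicat_real X x" for x
  proof (cases "x \<in> X")
    case True
    then have "infdist x (- X) > 0"
      using \<open>- X \<noteq> {}\<close> X(1) by (intro infdist_pos_not_in_closed) auto
    then obtain m where "1 \<le> real m * infdist x (- X)"
      by (metis less_imp_le reals_Archimedean3)
    then have "f k x = 1" if "k \<ge> m" for k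
      using mult_right_mono[of "real m" "real k" "infdist x (- X)"] that infdist_nonneg[of x "- X"]
      by (simp add: f_def)
    then show ?thesis
      using True by (intro tendsto_eventually eventually_sequentiallyI[of m]) auto
  qed (simp add: f_out)
  have lim: "(\<lambda>k. \<integral>x. f k x \<partial>L) \<longlonglongrightarrow> measure L X"
    if "finite_measure L" "sets L = sets borel" for L
  proof -
    interpret L: finite_measure L by fact
    have "(\<lambda>k. \<integral>x. f k x \<partial>L) \<longlonglongrightarrow> (\<integral>x. indicat_real X x \<partial>L)"
    proof (rule integral_dominated_convergence[where w = "\<lambda>x. 1"])
      show "f k \<in> borel_measurable L" for k
        by (rule continuous_measurable[OF locally_finite_finite_measure[OF that] f_cont])
      show "indicat_real X \<in> borel_measurable L"
        using X(1) that(2) by (intro borel_measurable_indicator) simp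
    qed (use f_lim f_le in auto)
    then show ?thesis
      using sets_eq_imp_space_eq[OF that(2)] by simp
  qed
  have "measure M X = measure N X"
    using lim[OF M] lim[OF N] by (simp add: eq[OF f_cont f_supp] LIMSEQ_unique)
  then show "emeasure M X = emeasure N X"
    by (simp add: M.emeasure_eq_measure N.emeasure_eq_measure)
qed simp_all

text \<open>The factor \<open>exp (\<beta> * h y)\<close> is moved to the Lebesgue side as a
  density, which is a finite measure because the partition function is finite; total mass 1 then
  determines \<open>c\<close>.\<close>

lemma KMS_imp_gibbs:
  fixes h :: "'a::hermitian_space \<Rightarrow> real"
  assumes e: "unitary_basis n e" and KMS: "KMS_condition n e \<beta> h \<mu>"
    and \<mu>: "prob_space \<mu>" "sets \<mu> = sets borel" and h: "class_C 1 h"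
    and Z: "partition_function \<beta> h < \<infinity>"
  shows "\<mu> = gibbs_measure \<beta> h"
proof -
  interpret prob_space \<mu> by fact
  let ?w = "\<lambda>u. exp (- \<beta> * h u)"
  have w: "class_C 1 ?w" by (intro class_C_exp_scaled h)
  have hm: "h \<in> borel_measurable lborel"
    using continuous_measurable[OF locally_finite_lborel class_C_continuous[OF h]] .
  obtain c where c: "c \<ge> 0" "\<And>\<phi>. class_C 1 \<phi> \<Longrightarrow> bounded_support \<phi> \<Longrightarrow>
      (\<integral>y. exp (\<beta> * h y) * \<phi> y \<partial>\<mu>) = c * (\<integral>y. \<phi> y \<partial>lborel)"
    using KMS_eq_lebesgue_integral[OF e KMS \<mu> h] by blast
  define \<nu> where "\<nu> = density lborel (\<lambda>u. ennreal (c * ?w u))"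
  have mass: "emeasure \<nu> UNIV = ennreal c * partition_function \<beta> h"
  proof -
    have "emeasure \<nu> UNIV = (\<integral>\<^sup>+u. ennreal c * ennreal (?w u) \<partial>lborel)"
      using c(1) hm by (simp add: \<nu>_def emeasure_density ennreal_mult)
    also have "\<dots> = ennreal c * partition_function \<beta> h"
      unfolding partition_function_def using hm by (intro nn_integral_cmult) simp
    finally show ?thesis .
  qed
  have fin: "finite_measure \<nu>"
  proof (rule finite_measureI)
    have "space \<nu> = UNIV" by (simp add: \<nu>_def)
    then show "emeasure \<nu> (space \<nu>) \<noteq> \<infinity>"
      using Z by (simp add: mass ennreal_mult_eq_top_iff less_top)
  qed
  have int_\<nu>: "(\<integral>u. f u \<partial>\<nu>) = c * (\<integral>u. ?w u * f u \<partial>lborel)" if "continuous_on UNIV f" for f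
    unfolding \<nu>_def
    by (subst integral_density)
       (use c(1) hm continuous_measurable[OF locally_finite_lborel that] in \<open>auto simp: mult.assoc\<close>)
  have lf: "locally_finite_measure \<mu>" "locally_finite_measure \<nu>"
    using \<mu>(2) fin by (intro locally_finite_finite_measure; simp add: \<nu>_def; unfold_locales)+
  have smooth: "(\<integral>u. \<xi> u \<partial>\<mu>) = (\<integral>u. \<xi> u \<partial>\<nu>)" if "test_function \<xi>" for \<xi>
  proof -
    have \<xi>: "class_C 1 \<xi>" "bounded_support \<xi>"
      using that unfolding test_function_iff by blast+
    \<comment> \<open>With \<open>?w y * \<xi> y\<close> in place of \<open>\<phi>\<close> the
      weights cancel on the left; this function is only C^1, as \<open>c(2)\<close> permits.\<close>
    have "(\<integral>y. exp (\<beta> * h y) * (?w y * \<xi> y) \<partial>\<mu>) = c * (\<integral>y. ?w y * \<xi> y \<partial>lborel)"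
      by (intro c(2) class_C_mult w \<xi> bounded_support_mult_right)
    moreover have "exp (\<beta> * h y) * (?w y * \<xi> y) = \<xi> y" for y
      by (simp add: mult.assoc[symmetric] exp_add[symmetric])
    ultimately show ?thesis
      by (simp only: int_\<nu>[OF class_C_continuous[OF \<xi>(1)]])
  qed
  obtain \<rho> :: "nat \<Rightarrow> 'a \<Rightarrow> real" where \<rho>: "\<And>k. mollifier (1 / Suc k) (\<rho> k)"
    using mollifier_sequence by blast
  have "\<mu> = \<nu>"
  proof (rule finite_measure_eqI_continuous)
    fix f :: "'a \<Rightarrow> real"
    assume f: "continuous_on UNIV f" "bounded_support f"
    obtain B where B: "\<And>u. \<bar>f u\<bar> \<le> B"
      using continuous_bounded_support_bounded[OF f] by blast
    \<comment> \<open>Equality on test functions passes to continuous functions through averages;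
      for a finite measure the constant \<open>B\<close> dominates.\<close>
    have lim: "(\<lambda>k. \<integral>u. average (\<rho> k) f u \<partial>L) \<longlonglongrightarrow> (\<integral>u. f u \<partial>L)"
      if L: "finite_measure L" "locally_finite_measure L" for L
    proof (rule integral_dominated_convergence[where w = "\<lambda>u. B"])
      show "integrable L (\<lambda>u. B)"
        using L(1) by (simp add: finite_measure.integrable_const)
      show "AE u in L. (\<lambda>k. average (\<rho> k) f u) \<longlonglongrightarrow> f u"
        by (intro AE_I2 average_tendsto f \<rho>)
      show "AE u in L. norm (average (\<rho> k) f u) \<le> B" for k
        using average_bounded[OF f(1) \<rho> B] by simp
    qed (intro continuous_measurable[OF L(2)] f test_function_continuous test_function_average[OF \<rho>])+
    have "finite_measure \<mu>" by unfold_locales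
    from lim[OF this lf(1)] lim[OF fin lf(2)] show "(\<integral>u. f u \<partial>\<mu>) = (\<integral>u. f u \<partial>\<nu>)"
      by (simp add: smooth[OF test_function_average[OF \<rho> f]] LIMSEQ_unique)
  qed (use \<mu>(2) fin in \<open>auto simp: \<nu>_def\<close>, unfold_locales)
  have space: "space \<mu> = UNIV"
    using sets_eq_imp_space_eq[OF \<mu>(2)] by simp
  have "ennreal c * partition_function \<beta> h = 1"
    using mass emeasure_space_1 space \<open>\<mu> = \<nu>\<close> by simp
  then have "c * enn2real (partition_function \<beta> h) = 1"
    using c(1) by (metis enn2real_1 enn2real_ennreal enn2real_mult)
  then have "c = 1 / enn2real (partition_function \<beta> h)"
    by (metis nonzero_eq_divide_eq mult_zero_right zero_neq_one)
  then show ?thesis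
    unfolding gibbs_measure_eq_density[OF class_C_continuous[OF h] Z] \<open>\<mu> = \<nu>\<close> \<nu>_def by simp
qed

theorem theorem4p2:
  fixes n :: nat
    and e :: "nat \<Rightarrow> 'a::hermitian_space"
    and h :: "'a \<Rightarrow> real"
    and \<beta> :: real
    and \<mu> :: "'a measure"
  assumes "unitary_basis n e"
    and "class_C 1 h"
    and "\<beta> > 0"
    and "partition_function \<beta> h < \<infinity>"
    and "sets \<mu> = sets borel"
    and "prob_space \<mu>"
  shows "KMS_condition n e \<beta> h \<mu> \<longleftrightarrow> \<mu> = gibbs_measure \<beta> h"
  using KMS_imp_gibbs[of n e \<beta> h \<mu>] KMS_gibbs[of h \<beta> n e] assms by blast

end
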